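(* Let $v_1,v_2,v_3$ be unit vectors in $\mathbb{R}^2$ with angle $2\pi/3$ between each pair. Then for every nonnegative $G\in L^2(\mathbb{R}^2)$ there exist nonnegative locally integrable functions $g_1,g_2,g_3$ on $\mathbb{R}^2$ such that $$G(x)\le g_1(x)^{1/3}g_2(x)^{1/3}g_3(x)^{1/3}\quad\text{for a.e. }x\in\mathbb{R}^2,$$ and, for each $j\in\{1,2,3\}$, for almost every line $l$ in $\mathbb{R}^2$ which is parallel to $v_j$, $$\int_l g_j\,d\lambda\le\|G\|_{L^2(\mathbb{R}^2)},$$ where $d\lambda$ denotes Lebesgue measure on $l$.
   Context: Lines parallel to $v_j$ are parametrised by $s\in\mathbb{R}$ via $l_s=\{s v_j^\perp+t v_j: t\in\mathbb{R}\}$, where $v_j^\perp$ is a unit vector orthogonal to $v_j$; "almost every line" means for Lebesgue-almost every $s$. *)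

theory Defs
  imports "HOL-Analysis.Analysis"
begin

definition angle_between :: "'a::real_inner \<Rightarrow> 'a \<Rightarrow> real" where
  "angle_between u v = arccos (inner u v / (norm u * norm v))"

definition in_L2 :: "('a::euclidean_space \<Rightarrow> real) \<Rightarrow> bool" where
  "in_L2 f \<longleftrightarrow> f \<in> borel_measurable lebesgue \<and> integrable lebesgue (\<lambda>x. (f x)\<^sup>2)"

definition L2_norm :: "('a::euclidean_space \<Rightarrow> real) \<Rightarrow> real" where
  "L2_norm f = sqrt (LINT x|lebesgue. (f x)\<^sup>2)"

definition locally_integrable :: "('a::euclidean_space \<Rightarrow> real) \<Rightarrow> bool" where
  "locally_integrable f \<longleftrightarrow> (\<forall>K. compact K \<longrightarrow> set_integrable lebesgue K f)"

(* The bound "integral of g over l <= C" for Lebesgue-almost every line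
   l_s = {s w + t v : t real} parallel to the unit vector v, where w is a unit vector
   orthogonal to v.  In the plane there are two such w; both are required.  As v is a unit
   vector, Lebesgue measure on l_s is Lebesgue measure in t.  Integrability on the line is
   demanded explicitly because the Bochner integral of a non-integrable function is 0. *)
definition ae_line_integral_le :: "real^2 \<Rightarrow> (real^2 \<Rightarrow> real) \<Rightarrow> real \<Rightarrow> bool" where
  "ae_line_integral_le v g C \<longleftrightarrow>
     (\<forall>w. norm w = 1 \<and> orthogonal w v \<longrightarrow>
       (AE s in lebesgue.
          integrable lebesgue (\<lambda>t. g (s *\<^sub>R w + t *\<^sub>R v)) \<and>
          (LINT t|lebesgue. g (s *\<^sub>R w + t *\<^sub>R v)) \<le> C))"

end

theory Submission
  imports Defs "HOL-Probability.Distributions" "HOL-Probability.Distribution_Functions"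
begin

text \<open>
  Let $e_j$ be a unit normal of $v_j$, so that the functions constant on the lines parallel to $v_j$
  are those of the form $x \mapsto f_j(e_j \cdot x)$.  The statement is the convex dual of the
  inequality
  $$\int G(x) \prod_j f_j(e_j \cdot x)^{1/3}\,dx \le \|G\|_2 \prod_j \Bigl(\int f_j\Bigr)^{1/3},$$
  which follows by the Cauchy--Schwarz inequality from the geometric Brascamp--Lieb inequality
  $\int \prod_j f_j(e_j \cdot x)^{2/3}\,dx \le \prod_j (\int f_j)^{2/3}$.  The constant there is $1$
  because the $e_j$ form a tight frame: $\frac23 \sum_j e_j \otimes e_j$ is the identity.

  The factors $g_j$ come from an extremal problem.  Write $H_f(x) = \prod_j f_j(e_j \cdot x)^{1/3}$ and
  let $f$ maximise $\int G H_f$ over all nonnegative triples with $\int f_j \le 1$, with maximum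
  $M \le \|G\|_2$.  Replacing $f_j$ by a multiple of $(1+\epsilon 1_A) f_j$ and letting $\epsilon$ tend to
  $0$ shows that the integral of $G H_f$ over almost every line $e_j \cdot x = s$ is at most $M f_j(s)$
  (\<open>euler_lagrange\<close>).  Hence $g_j(x) = G(x) H_f(x) / f_j(e_j \cdot x)$ has line integrals at most $M$,
  and $\prod_j g_j = G^3$ wherever all $f_j(e_j \cdot x)$ are positive.

  A maximiser may vanish at points where $G$ is positive.  If $M = \|G\|_2$ this does not happen,
  because equality in the Cauchy--Schwarz inequality makes $G$ proportional to $H_f$.  If
  $M < \|G\|_2$ there is room to spare: the problem is posed for triples $f_j \ge p$ with
  $\int (f_j - p) \le 1$, where $p$ is a small multiple of a Gaussian.  By homogeneity its
  maximum is at most $(1 + \int p) M$, which is still at most $\|G\|_2$, and its maximisers are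
  positive everywhere.  The variation above increases $f_j$ and scales down only $f_j - p$, so it
  respects the constraint.

  Maximisers exist (\<open>maximiser_exists\<close>) although the functions $f_j$ are bounded only in $L^1$.
  Among near-maximisers one selects a sequence that nearly minimises the strictly convex functional
  $\sum_j \int e^{-f_j}$ against a Gaussian weight; as near-maximisers form a convex set, the selected
  sequence has an almost everywhere convergent subsequence (\<open>convex_selection\<close>).  Mass may be
  lost in the limit, which the constraint permits by Fatou's lemma, but the pairing with $G$ is not:
  by the Brascamp--Lieb inequality the functions $H_f$ are bounded in $L^2$, and bounded sequences in $L^2$
  that converge almost everywhere converge weakly.

  The Brascamp--Lieb inequality is proved by Barthe's transport argument: each $f_j$ is transported
  monotonically to the standard Gaussian density, the three transports are assembled to an injective map of
  the plane, and the inequality becomes a bound for its Jacobian determinant together with the integral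
  of the Gaussian in the plane.
\<close>

section \<open>Lebesgue measure on the plane in orthonormal coordinates\<close>

lemma vector_2_measurable: "(\<lambda>(s, t). vector [s, t] :: real^2) \<in> borel_measurable (lborel \<Otimes>\<^sub>M lborel)"
proof -
  have eq: "(\<lambda>(s::real, t::real). vector [s, t] :: real^2) = (\<lambda>p. fst p *\<^sub>R axis 1 1 + snd p *\<^sub>R axis 2 1)"
    by (auto simp: fun_eq_iff vec_eq_iff forall_2 axis_def)
  show ?thesis unfolding eq by measurable
qed

lemma lborel_vec2: "distr (lborel \<Otimes>\<^sub>M lborel) borel (\<lambda>(s, t). vector [s, t] :: real^2) = lborel"
proof (rule lborel_eqI[symmetric])
  note vector_2_measurable[measurable]
  fix l u :: "real^2" assume le: "\<And>b. b \<in> Basis \<Longrightarrow> l \<bullet> b \<le> u \<bullet> b"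
  have le': "l $ i \<le> u $ i" for i
    using le[of "axis i 1"] by (simp add: axis_in_Basis_iff inner_axis)
  have pre: "(\<lambda>(s, t). vector [s, t] :: real^2) -` box l u \<inter> space (lborel \<Otimes>\<^sub>M lborel)
      = {l$1<..<u$1} \<times> {l$2<..<u$2}"
    by (auto simp: mem_box_cart forall_2 space_pair_measure)
  have inj: "inj (\<lambda>i::2. axis i (1::real))" by (simp add: inj_on_def axis_eq_axis)
  have B: "(Basis :: (real^2) set) = range (\<lambda>i. axis i 1)"
    by (auto simp: Basis_vec_def)
  have "(\<Prod>b\<in>Basis. (u - l) \<bullet> b) = (u$1-l$1) * (u$2-l$2)"
    unfolding B prod.reindex[OF inj] by (simp add: inner_axis UNIV_2)
  then show "emeasure (distr (lborel \<Otimes>\<^sub>M lborel) borel (\<lambda>(s, t). vector [s, t] :: real^2)) (box l u)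
      = (\<Prod>b\<in>Basis. (u - l) \<bullet> b)"
    using le'[of 1] le'[of 2]
    by (subst emeasure_distr) (auto simp: pre lborel.emeasure_pair_measure_Times ennreal_mult)
qed simp

text \<open>Images under the inverse map turn the preimage of a box into an orthogonal image, whose volume is known.\<close>
lemma lborel_orthogonal:
  fixes f :: "real^'n::{finite,wellorder} \<Rightarrow> real^'n::_"
  assumes f: "orthogonal_transformation f"
  shows "distr lborel borel f = lborel"
proof (rule lborel_eqI[symmetric])
  have lin: "linear f" and "inj f" "surj f"
    using f orthogonal_transformation_linear orthogonal_transformation_inj orthogonal_transformation_surj by blast+
  have [measurable]: "f \<in> borel_measurable borel"
    using lin by (simp add: borel_measurable_continuous_onI linear_continuous_on linear_linear)
  fix l u :: "real^'n::{finite,wellorder}" assume le: "\<And>b. b \<in> Basis \<Longrightarrow> l \<bullet> b \<le> u \<bullet> b"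
  have oi: "orthogonal_transformation (inv f)" using f by (rule orthogonal_transformation_inv)
  have vi: "f -` box l u = inv f ` box l u"
    by (simp add: bij_def \<open>inj f\<close> \<open>surj f\<close> bij_vimage_eq_inv_image)
  have m: "measure lebesgue (f -` box l u) = measure lebesgue (box l u)"
    unfolding vi by (rule measure_orthogonal_image[OF oi]) simp
  have lm: "f -` box l u \<in> lmeasurable"
    unfolding vi by (rule measurable_orthogonal_image[OF oi]) simp
  have b: "f -` box l u \<in> sets borel"
    using measurable_sets[of f borel borel "box l u"] by simp
  have "emeasure lborel (f -` box l u) = ennreal (measure lebesgue (f -` box l u))"
    using emeasure_eq_measure2[OF lm] b by simp
  also have "\<dots> = emeasure lborel (box l u)"
    using emeasure_eq_measure2[of "box l u" lebesgue] m by simp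
  finally show "emeasure (distr lborel borel f) (box l u) = (\<Prod>b\<in>Basis. (u - l) \<bullet> b)"
    using le by (simp add: emeasure_distr emeasure_lborel_box)
qed simp

text \<open>Tonelli's theorem on the lines parallel to $v$: every statement about almost every line is reduced to this formula.\<close>
lemma nn_integral_orthonormal_frame:
  fixes w v :: "real^2" and h :: "real^2 \<Rightarrow> ennreal"
  assumes [simp]: "norm w = 1" "norm v = 1" and wv: "w \<bullet> v = 0"
    and h[measurable]: "h \<in> borel_measurable borel"
  shows "(\<integral>\<^sup>+x. h x \<partial>lborel) = (\<integral>\<^sup>+s. \<integral>\<^sup>+t. h (s *\<^sub>R w + t *\<^sub>R v) \<partial>lborel \<partial>lborel)"
proof -
  define f where "f x = (x$1) *\<^sub>R w + (x$2) *\<^sub>R v" for x :: "real^2"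
  have lin: "linear f" by (rule linearI) (auto simp: f_def algebra_simps)
  have on: "w \<bullet> w = 1" "v \<bullet> v = 1" "v \<bullet> w = 0" using wv by (auto simp: dot_square_norm inner_commute)
  have "f x \<bullet> f y = x \<bullet> y" for x y
  proof -
    have "f x \<bullet> f y = x$1 * y$1 + x$2 * y$2"
      by (simp add: f_def inner_add_left inner_add_right on wv)
    then show ?thesis by (simp add: inner_vec_def sum_2)
  qed
  then have of: "orthogonal_transformation f"
    unfolding orthogonal_transformation_def using lin by blast
  have m[measurable]: "f \<in> borel_measurable borel"
    using lin by (simp add: borel_measurable_continuous_onI linear_continuous_on linear_linear)
  have "(\<integral>\<^sup>+x. h x \<partial>lborel) = (\<integral>\<^sup>+x. h x \<partial>distr lborel borel f)"
    by (simp add: lborel_orthogonal[OF of])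
  also have "\<dots> = (\<integral>\<^sup>+x. h (f x) \<partial>lborel)" by (rule nn_integral_distr) auto
  also have "\<dots> = (\<integral>\<^sup>+x. h (f x) \<partial>distr (lborel \<Otimes>\<^sub>M lborel) borel (\<lambda>(s, t). vector [s, t] :: real^2))"
    by (simp add: lborel_vec2)
  also have "\<dots> = (\<integral>\<^sup>+p. h (f (case p of (s, t) \<Rightarrow> vector [s, t])) \<partial>(lborel \<Otimes>\<^sub>M lborel))"
    by (rule nn_integral_distr[OF vector_2_measurable]) auto
  also have "\<dots> = (\<integral>\<^sup>+p. h (fst p *\<^sub>R w + snd p *\<^sub>R v) \<partial>(lborel \<Otimes>\<^sub>M lborel))"
    by (simp add: f_def split_beta)
  also have "\<dots> = (\<integral>\<^sup>+s. \<integral>\<^sup>+t. h (s *\<^sub>R w + t *\<^sub>R v) \<partial>lborel \<partial>lborel)"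
    by (subst lborel.nn_integral_fst[symmetric]) auto
  finally show ?thesis .
qed

lemma nn_integral_std_normal: "(\<integral>\<^sup>+t. ennreal (std_normal_density t) \<partial>lborel) = 1"
proof -
  interpret prob_space "density lborel std_normal_density" by (rule prob_space_normal_density) simp
  show ?thesis using emeasure_space_1 by (simp add: emeasure_density)
qed

text \<open>This is the value that normalises the constant in the Brascamp--Lieb inequality to $1$.\<close>
lemma std_normal_pair:
  "(\<integral>\<^sup>+y. ennreal (1 / (2 * pi) * exp (- (y \<bullet> y) / 2)) \<partial>(lborel :: (real^2) measure)) = 1"
proof -
  have [simp]: "(\<integral>\<^sup>+t. ennreal (std_normal_density t) \<partial>lborel) = 1"
    by (rule nn_integral_std_normal) 
  have prd: "1 / (2 * pi) * exp (- ((s *\<^sub>R axis 1 1 + t *\<^sub>R axis 2 1 :: real^2) \<bullet> (s *\<^sub>R axis 1 1 + t *\<^sub>R axis 2 1)) / 2)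
    = std_normal_density s * std_normal_density t" for s t :: real
  proof -
    have "(s *\<^sub>R axis 1 1 + t *\<^sub>R axis 2 1 :: real^2) \<bullet> (s *\<^sub>R axis 1 1 + t *\<^sub>R axis 2 1) = s\<^sup>2 + t\<^sup>2"
      by (simp add: inner_vec_def sum_2 axis_def power2_eq_square)
    moreover have "exp (- (s\<^sup>2 + t\<^sup>2) / 2) = exp (- s\<^sup>2 / 2) * exp (- t\<^sup>2 / 2)"
      by (simp add: exp_add[symmetric] add_divide_distrib)
    ultimately show ?thesis
      unfolding std_normal_density_def by (simp add: field_simps)
  qed
  have "(\<integral>\<^sup>+y. ennreal (1 / (2 * pi) * exp (- (y \<bullet> y) / 2)) \<partial>(lborel :: (real^2) measure))
    = (\<integral>\<^sup>+s. \<integral>\<^sup>+t. ennreal (std_normal_density s) * ennreal (std_normal_density t) \<partial>lborel \<partial>lborel)"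
    by (subst nn_integral_orthonormal_frame[of "axis 1 1" "axis 2 1"], unfold prd)
       (simp_all add: ennreal_mult inner_axis_axis)
  also have "\<dots> = 1" by (simp add: nn_integral_cmult)
  finally show ?thesis .
qed

section \<open>Monotone transport and injective changes of variables\<close>

text \<open>Positivity makes the distribution function an increasing $C^1$ bijection onto the open unit interval, so it can be inverted with a nonvanishing derivative.\<close>
lemma cdf_of_positive_density:
  fixes f :: "real \<Rightarrow> real"
  assumes cont: "continuous_on UNIV f" and pos: "\<And>s. 0 < f s"
    and int: "(\<integral>\<^sup>+s. ennreal (f s) \<partial>lborel) = 1"
  defines "F \<equiv> cdf (density lborel f)"
  shows "(F has_real_derivative f s) (at s)" "strict_mono F" "range F = {0<..<1}"
proof -
  let ?M = "density lborel f"
  have [measurable]: "f \<in> borel_measurable borel"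
    using cont by (simp add: borel_measurable_continuous_onI)
  interpret prob_space ?M
    by (rule prob_spaceI) (simp add: emeasure_density int)
  interpret real_distribution ?M
    by unfold_locales simp
  have diff: "F b - F a = integral {a..b} f" if "a < b" for a b
  proof -
    have fi: "f integrable_on {a..b}" 
      using cont continuous_on_subset integrable_continuous_interval by blast
    have nn: "0 \<le> integral {a..b} f" using pos by (intro integral_nonneg fi) (simp add: less_imp_le)
    have "emeasure ?M {a<..b} = (\<integral>\<^sup>+s. ennreal (f s) * indicator {a<..b} s \<partial>lborel)"
      by (simp add: emeasure_density)
    also have "\<dots> = (\<integral>\<^sup>+s. indicator {a..b} s * ennreal (f s) \<partial>lborel)"
      using AE_lborel_singleton[of a] by (intro nn_integral_cong_AE) (auto elim!: eventually_mono split: split_indicator)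
    also have "\<dots> = ennreal (integral {a..b} f)"
      using nn_integral_has_integral_lebesgue[OF less_imp_le[OF pos] integrable_integral[OF fi]]
      by (simp add: nn_integral_completion indicator_mult_ennreal)
    finally have "measure ?M {a<..b} = integral {a..b} f"
      using nn by (simp add: measure_def)
    then show ?thesis using cdf_diff_eq[OF that] by (simp add: F_def)
  qed
  show der: "(F has_real_derivative f s) (at s)" for s
  proof -
    have "((\<lambda>u. integral {s-1..u} f) has_vector_derivative f s) (at s within {s-1..s+1})"
      by (rule integral_has_vector_derivative) (use cont continuous_on_subset in auto)
    then have "((\<lambda>u. F (s-1) + integral {s-1..u} f) has_real_derivative f s) (at s within {s-1..s+1})"
      unfolding has_real_derivative_iff_has_vector_derivative
      by (auto intro!: derivative_eq_intros)
    then have "((\<lambda>u. F (s-1) + integral {s-1..u} f) has_real_derivative f s) (at s)"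
      by (subst (asm) at_within_interior) auto
    moreover have "eventually (\<lambda>u. F (s-1) + integral {s-1..u} f = F u) (nhds s)"
      using eventually_nhds_in_open[of "{s-1<..}" s]
      by (auto elim!: eventually_mono simp: diff[symmetric])
    ultimately show ?thesis
      by (subst DERIV_cong_ev[OF refl _ refl, symmetric]) auto
  qed
  show sm: "strict_mono F"
    by (rule strict_monoI) (metis DERIV_pos_imp_increasing der pos)
  have cF: "continuous_on UNIV F" using der by (meson DERIV_continuous_on)
  have b0: "(F \<longlongrightarrow> 0) at_bot" unfolding F_def by (rule cdf_lim_at_bot)
  have b1: "(F \<longlongrightarrow> 1) at_top" unfolding F_def by (rule cdf_lim_at_top_prob)
  show "range F = {0<..<1}"
  proof (intro equalityI subsetI)
    fix y assume "y \<in> range F"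
    then obtain x where y: "y = F x" by auto
    have "F (x - 1) < F x" "F x < F (x+1)" using sm by (auto simp: strict_mono_less)
    moreover have "0 \<le> F (x-1)" "F (x+1) \<le> 1" unfolding F_def by (auto simp: cdf_def)
    ultimately show "y \<in> {0<..<1}" using y by auto
  next
    fix y :: real assume y: "y \<in> {0<..<1}"
    have "eventually (\<lambda>x. F x < y) at_bot" using y by (intro order_tendstoD[OF b0]) auto
    then obtain a where a: "F a < y" by (auto simp: eventually_at_bot_linorder)
    have "eventually (\<lambda>x. F x > y) at_top" using y by (intro order_tendstoD[OF b1]) auto
    then obtain b where b: "F b > y" by (auto simp: eventually_at_top_linorder)
    have "a \<le> b" using a b sm by (metis less_trans not_le order.asym strict_mono_less)
    then obtain x where "F x = y"
      using IVT'[of F a y b] a b continuous_on_subset[OF cF] by auto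
    then show "y \<in> range F" by auto
  qed
qed

text \<open>The monotone transport is $T = G^{-1} \circ F$ with the distribution functions $F$ of $f$ and $G$ of $g$; differentiating $G(T(s)) = F(s)$ gives the asserted equation.\<close>
lemma transport_between_positive_densities:
  fixes f g :: "real \<Rightarrow> real"
  assumes f: "continuous_on UNIV f" "\<And>s. 0 < f s" "(\<integral>\<^sup>+s. ennreal (f s) \<partial>lborel) = 1"
    and g: "continuous_on UNIV g" "\<And>s. 0 < g s" "(\<integral>\<^sup>+s. ennreal (g s) \<partial>lborel) = 1"
  obtains T T' where "\<And>s. (T has_real_derivative T' s) (at s)" "\<And>s. 0 < T' s"
    "\<And>s. f s = T' s * g (T s)"
proof -
  define F where "F = cdf (density lborel f)"
  define G where "G = cdf (density lborel g)"
  note F = cdf_of_positive_density[OF f, folded F_def]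
  note G = cdf_of_positive_density[OF g, folded G_def]
  have injG: "inj G" using G(2) by (rule strict_mono_imp_inj_on)
  define K where "K = inv G"
  have KG: "K (G y) = y" for y using injG by (simp add: K_def)
  have GK: "G (K u) = u" if "0 < u" "u < 1" for u
    unfolding K_def by (rule f_inv_into_f) (use that G(3) in auto)
  have cG: "isCont G y" for y using G(1) by (rule DERIV_isCont)
  have F01: "0 < F s" "F s < 1" for s using F(3) by auto
  have dK: "(K has_real_derivative inverse (g (K (F s)))) (at (F s))" for s
  proof (rule DERIV_inverse_function[OF G(1)])
    show "g (K (F s)) \<noteq> 0" using g(2)[of "K (F s)"] by simp
    show "0 < F s" "F s < 1" using F01 by auto
    show "G (K y) = y" if "0 < y" "y < 1" for y using GK that by simp
    have "isCont K (G (K (F s)))"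
      by (rule isCont_inverse_function[of 1]) (auto simp: KG cG)
    then show "isCont K (F s)" by (simp add: GK F01)
  qed
  show ?thesis
  proof
    show "((\<lambda>s. K (F s)) has_real_derivative inverse (g (K (F s))) * f s) (at s)" for s
      by (rule DERIV_chain2[OF dK F(1)])
    show "0 < inverse (g (K (F s))) * f s" for s using f(2) g(2) by simp
    show "f s = (inverse (g (K (F s))) * f s) * g (K (F s))" for s
      using g(2)[of "K (F s)"] by (simp add: field_simps)
  qed
qed

text \<open>The right-hand side exceeds the left-hand side by the integral of $f$ outside the range of $g$.\<close>
lemma nn_integral_change_of_variables_le:
  fixes g :: "real^'n::{finite,wellorder} \<Rightarrow> real^'n::_" and f :: "real^'n::_ \<Rightarrow> real"
  assumes der: "\<And>x. (g has_derivative g' x) (at x)" and inj: "inj g"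
    and f: "integrable lborel f" "\<And>x. 0 \<le> f x"
  shows "(\<integral>\<^sup>+x. ennreal (\<bar>det (matrix (g' x))\<bar> * f (g x)) \<partial>lborel) \<le> (\<integral>\<^sup>+x. ennreal (f x) \<partial>lborel)"
proof -
  let ?d = "\<lambda>x. \<bar>det (matrix (g' x))\<bar> * f (g x)"
  have fa: "f absolutely_integrable_on UNIV"
    using f(1) by (simp add: set_integrable_def integrable_completion)
  have "g differentiable_on UNIV"
    using der unfolding differentiable_on_def differentiable_def by blast
  then have im: "range g \<in> sets lebesgue"
    by (intro differentiable_image_in_sets_lebesgue) auto
  then have fr: "f absolutely_integrable_on range g"
    using set_integrable_subset[OF fa] by auto
  have "(\<lambda>x. vec (f x) :: real^1) absolutely_integrable_on range g
      \<and> integral (range g) (\<lambda>x. vec (f x) :: real^1) = vec (integral (range g) f)"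
    using fr by (simp add: absolutely_integrable_on_1_iff integral_on_1_eq)
  then have "(\<lambda>x. \<bar>det (matrix (g' x))\<bar> *\<^sub>R (vec (f (g x)) :: real^1)) absolutely_integrable_on UNIV \<and>
      integral UNIV (\<lambda>x. \<bar>det (matrix (g' x))\<bar> *\<^sub>R (vec (f (g x)) :: real^1)) = vec (integral (range g) f)"
    by (subst has_absolute_integral_change_of_variables) (use der inj in auto)
  then have d: "?d absolutely_integrable_on UNIV" "integral UNIV ?d = integral (range g) f"
    by (auto simp: absolutely_integrable_on_1_iff integral_on_1_eq)
  have dl: "integrable lebesgue ?d" using d(1) by (simp add: set_integrable_def)
  have "(\<integral>\<^sup>+x. ennreal (?d x) \<partial>lborel) = (\<integral>\<^sup>+x. ennreal (?d x) \<partial>lebesgue)"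
    by (simp add: nn_integral_completion)
  also have "\<dots> = ennreal (LINT x|lebesgue. ?d x)"
    by (rule nn_integral_eq_integral[OF dl]) (simp add: f)
  also have "(LINT x|lebesgue. ?d x) = integral UNIV ?d"
    using set_lebesgue_integral_eq_integral(2)[OF d(1)] by (simp add: set_lebesgue_integral_def)
  also have "\<dots> \<le> integral UNIV f"
    unfolding d(2) using fa fr f(2)
    by (intro integral_subset_le) (auto simp: absolutely_integrable_on_def)
  also have "integral UNIV f = (LINT x|lebesgue. f x)"
    using set_lebesgue_integral_eq_integral(2)[OF fa] by (simp add: set_lebesgue_integral_def)
  also have "ennreal \<dots> = (\<integral>\<^sup>+x. ennreal (f x) \<partial>lebesgue)"
    by (rule nn_integral_eq_integral[symmetric]) (use f integrable_completion[of f lborel] in auto)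
  finally show ?thesis by (simp add: nn_integral_completion ennreal_leI)
qed

section \<open>Three unit vectors at mutual angle $2\<pi>/3$\<close>

lemma prod_3: "prod f (UNIV::3 set) = f 1 * f 2 * f 3"
  unfolding UNIV_3 by (simp add: ac_simps)

lemma AM_GM_3:
  fixes a :: "3 \<Rightarrow> real"
  assumes "\<And>j. 0 \<le> a j"
  shows "(\<Prod>j\<in>UNIV. a j) powr (1/3) \<le> (\<Sum>j\<in>UNIV. a j) / 3"
  using arith_geom_mean[of "UNIV :: 3 set" a] assms by (simp add: sum_divide_distrib)

text \<open>The vectors $e_j$ stand for unit normals of the three given directions.  They inherit the angles, so they are described by their inner products.\<close>
locale tripod =
  fixes e :: "3 \<Rightarrow> real^2"
  assumes norm_e: "norm (e j) = 1"
    and inner_e: "i \<noteq> j \<Longrightarrow> e i \<bullet> e j = - 1/2"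
begin

lemma sq_e: "(e j $ 1)\<^sup>2 + (e j $ 2)\<^sup>2 = 1"
  using norm_e[of j] by (simp add: norm_eq_1 inner_vec_def sum_2 power2_eq_square)

lemma dot_e: "i \<noteq> j \<Longrightarrow> e i $ 1 * e j $ 1 + e i $ 2 * e j $ 2 = - 1/2"
  using inner_e[of i j] by (simp add: inner_vec_def sum_2)

lemma wedge_e: "i \<noteq> j \<Longrightarrow> (e i $ 1 * e j $ 2 - e i $ 2 * e j $ 1)\<^sup>2 = 3/4"
proof -
  assume ij: "i \<noteq> j"
  have "(e i $ 1 * e j $ 2 - e i $ 2 * e j $ 1)\<^sup>2 =
    ((e i $ 1)\<^sup>2 + (e i $ 2)\<^sup>2) * ((e j $ 1)\<^sup>2 + (e j $ 2)\<^sup>2) - (e i $ 1 * e j $ 1 + e i $ 2 * e j $ 2)\<^sup>2"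
    by (simp add: power2_eq_square algebra_simps)
  also have "\<dots> = 3/4" unfolding sq_e dot_e[OF ij] by (simp add: power2_eq_square)
  finally show ?thesis .
qed

lemma sum_e: "e 1 + e 2 + e 3 = 0"
proof -
  have "norm (e 1 + e 2 + e 3) ^ 2 = 0"
    unfolding power2_norm_eq_inner
    using norm_e[of 1] norm_e[of 2] norm_e[of 3] inner_e[of 1 2] inner_e[of 1 3] inner_e[of 2 3]
      inner_e[of 2 1] inner_e[of 3 1] inner_e[of 3 2]
    by (simp add: inner_add_left inner_add_right norm_eq_1)
  then show ?thesis by simp
qed

text \<open>This is the identity $\frac23 \sum_j e_j \otimes e_j = 1$ as a quadratic form, the geometric condition behind the constant $1$ in the Brascamp--Lieb inequality.\<close>
lemma tight_frame: "(\<Sum>j\<in>UNIV. (e j \<bullet> x)\<^sup>2) = 3/2 * (x \<bullet> x)"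
proof -
  define a b c d where "a = e 1 $ 1" "b = e 1 $ 2" "c = e 2 $ 1" "d = e 2 $ 2"
  note abcd = this
  have ab: "a\<^sup>2 + b\<^sup>2 = 1" and cd: "c\<^sup>2 + d\<^sup>2 = 1" and dot: "a * c + b * d = -1/2"
    using sq_e[of 1] sq_e[of 2] dot_e[of 1 2] by (simp_all add: abcd)
  \<comment> \<open>Expressing $e_2$ in the orthonormal basis of $e_1$ and its rotation leaves a polynomial identity modulo $a^2 + b^2 = 1$ and $k^2 = 3/4$.\<close>
  define k where "k = a * d - b * c"
  have k: "k\<^sup>2 = 3/4" using wedge_e[of 1 2] by (simp add: abcd k_def)
  have "c = (a\<^sup>2 + b\<^sup>2) * c" using ab by simp
  also have "\<dots> = a * (a * c + b * d) - b * k" by (simp add: k_def algebra_simps power2_eq_square)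
  finally have c: "c = - a / 2 - b * k" by (simp add: dot)
  have "d = (a\<^sup>2 + b\<^sup>2) * d" using ab by simp
  also have "\<dots> = b * (a * c + b * d) + a * k" by (simp add: k_def algebra_simps power2_eq_square)
  finally have d: "d = - b / 2 + a * k" by (simp add: dot)
  have e3: "e 3 $ i = - (e 1 $ i) - e 2 $ i" for i
    using arg_cong[OF sum_e, of "\<lambda>x. x $ i"] by (simp add: algebra_simps)
  let ?x = "x $ 1" and ?y = "x $ 2"
  have "(\<Sum>j\<in>UNIV. (e j \<bullet> x)\<^sup>2) = (a * ?x + b * ?y)\<^sup>2 + (c * ?x + d * ?y)\<^sup>2 + ((a + c) * ?x + (b + d) * ?y)\<^sup>2"
    by (simp add: sum_3 inner_vec_def sum_2 e3 abcd power2_eq_square algebra_simps)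
  also have "\<dots> = (3/2 + 0) * ((a\<^sup>2+b\<^sup>2) * (?x\<^sup>2 + ?y\<^sup>2)) + 2 * (k\<^sup>2 - 3/4) * (b * ?x - a * ?y)\<^sup>2"
    unfolding c d by (simp add: power2_eq_square field_simps)
  also have "\<dots> = 3/2 * (x \<bullet> x)" unfolding ab k by (simp add: inner_vec_def sum_2 power2_eq_square)
  finally show ?thesis .
qed

text \<open>Cauchy--Binet: the determinant of $\frac23 \sum_j a_j\, e_j \otimes e_j$ is $\frac49 \sum_{i<j} a_i a_j (e_i \wedge e_j)^2$, and each wedge product squares to $3/4$.\<close>
lemma det_tripod:
  fixes a :: "3 \<Rightarrow> real"
  shows "det (matrix (\<lambda>h. \<Sum>j\<in>UNIV. (2/3 * (a j * (e j \<bullet> h))) *\<^sub>R e j))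
     = (a 1 * a 2 + a 1 * a 3 + a 2 * a 3) / 3"
proof -
  have ent: "matrix (\<lambda>h. \<Sum>j\<in>UNIV. (2/3 * (a j * (e j \<bullet> h))) *\<^sub>R e j) $ i $ k
      = (\<Sum>j\<in>UNIV. 2/3 * (a j * e j $ k) * e j $ i)" for i k
    by (simp add: matrix_def inner_axis)
  let ?w = "\<lambda>i j. (e i $ 1 * e j $ 2 - e i $ 2 * e j $ 1)\<^sup>2"
  have "det (matrix (\<lambda>h. \<Sum>j\<in>UNIV. (2/3 * (a j * (e j \<bullet> h))) *\<^sub>R e j))
    = 4/9 * (a 1 * a 2 * ?w 1 2 + a 1 * a 3 * ?w 1 3 + a 2 * a 3 * ?w 2 3)"
    unfolding det_2 ent unfolding sum_3 power2_eq_square by algebra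
  then show ?thesis by (simp add: wedge_e)
qed

text \<open>With the three products $a_i a_j$ as arguments, the inequality of arithmetic and geometric means is sharp at $a_1 = a_2 = a_3$, which is why no constant is lost.\<close>
lemma det_tripod_ge:
  fixes a :: "3 \<Rightarrow> real"
  assumes a: "\<And>j. 0 < a j"
  shows "((\<Prod>j\<in>UNIV. a j) powr (1/3))\<^sup>2 \<le> \<bar>det (matrix (\<lambda>h. \<Sum>j\<in>UNIV. (2/3 * (a j * (e j \<bullet> h))) *\<^sub>R e j))\<bar>"
proof -
  have p: "0 < a 1" "0 < a 2" "0 < a 3" using a by auto
  \<comment> \<open>The product of the two numbers other than $a_j$.\<close>
  define b :: "3 \<Rightarrow> real" where "b j = (\<Prod>i\<in>UNIV. a i) / a j" for j
  have b: "0 \<le> b j" for j unfolding b_def by (intro divide_nonneg_pos prod_nonneg a) (simp add: a less_imp_le)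
  have P: "(\<Prod>i\<in>UNIV. a i) = a 1 * a 2 * a 3" by (simp add: prod_3)
  have Pb: "(\<Prod>i\<in>UNIV. b i) = (\<Prod>i\<in>UNIV. a i)\<^sup>2"
    using p unfolding b_def P prod_3 by (simp add: field_simps power2_eq_square)
  have "((\<Prod>j\<in>UNIV. a j) powr (1/3))\<^sup>2 = (\<Prod>i\<in>UNIV. b i) powr (1/3)"
    unfolding Pb using p by (simp add: P powr_powr flip: powr_numeral)
  also have "\<dots> \<le> (\<Sum>i\<in>UNIV. b i) / 3" by (rule AM_GM_3[OF b])
  also have "\<dots> = (a 1 * a 2 + a 1 * a 3 + a 2 * a 3) / 3"
    using p unfolding b_def P by (simp add: sum_3 field_simps)
  also have "\<dots> \<le> \<bar>det (matrix (\<lambda>h. \<Sum>j\<in>UNIV. (2/3 * (a j * (e j \<bullet> h))) *\<^sub>R e j))\<bar>"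
    unfolding det_tripod by (rule abs_ge_self)
  finally show ?thesis .
qed

text \<open>Dual to the frame identity: the analysis map $x \mapsto (e_j \cdot x)_j$ and its adjoint have the same norm.  Expanding one copy of $y$ and absorbing $e_j \cdot y$ by means of the frame identity gives the bound.\<close>
lemma norm_synthesis_le:
  fixes c :: "3 \<Rightarrow> real"
  defines "y \<equiv> \<Sum>j\<in>UNIV. (2/3 * c j) *\<^sub>R e j"
  shows "y \<bullet> y \<le> 2/3 * (\<Sum>j\<in>UNIV. (c j)\<^sup>2)"
proof -
  have "y \<bullet> y = (\<Sum>j\<in>UNIV. 2/3 * (c j * (e j \<bullet> y)))"
    by (subst y_def) (simp add: inner_sum_left mult_ac)
  also have "\<dots> \<le> (\<Sum>j\<in>UNIV. 2/3 * (((c j)\<^sup>2 + (e j \<bullet> y)\<^sup>2) / 2))"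
    by (intro sum_mono mult_left_mono) (use sum_squares_bound[of "c _" "e _ \<bullet> y"] in \<open>auto simp: mult_ac\<close>)
  also have "\<dots> = 1/3 * (\<Sum>j\<in>UNIV. (c j)\<^sup>2) + 1/3 * (\<Sum>j\<in>UNIV. (e j \<bullet> y)\<^sup>2)"
    by (simp add: sum_3 field_simps)
  finally show ?thesis unfolding tight_frame by simp
qed

text \<open>The map is strictly monotone: $(x - y) \cdot (\Theta(x) - \Theta(y))$ is a sum of nonnegative terms that vanish only if $e_j \cdot x = e_j \cdot y$.\<close>
lemma synthesis_inj:
  fixes T :: "3 \<Rightarrow> real \<Rightarrow> real"
  assumes "\<And>j. strict_mono (T j)"
  shows "inj (\<lambda>x. \<Sum>j\<in>UNIV. (2/3 * T j (e j \<bullet> x)) *\<^sub>R e j)" (is "inj ?\<Theta>")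
proof (rule injI, rule ccontr)
  fix x y assume eq: "?\<Theta> x = ?\<Theta> y" and ne: "x \<noteq> y"
  have "0 = (x - y) \<bullet> (?\<Theta> x - ?\<Theta> y)" using eq by simp
  also have "\<dots> = (\<Sum>j\<in>UNIV. 2/3 * ((e j \<bullet> x - e j \<bullet> y) * (T j (e j \<bullet> x) - T j (e j \<bullet> y))))"
    by (simp add: inner_sum_right sum_subtractf[symmetric] inner_diff_right inner_diff_left inner_commute algebra_simps
      diff_divide_distrib add_divide_distrib)
  finally have z: "(\<Sum>j\<in>UNIV. 2/3 * ((e j \<bullet> x - e j \<bullet> y) * (T j (e j \<bullet> x) - T j (e j \<bullet> y)))) = 0" by simp
  have pos: "0 < (e j \<bullet> x - e j \<bullet> y) * (T j (e j \<bullet> x) - T j (e j \<bullet> y))" if "e j \<bullet> x \<noteq> e j \<bullet> y" for j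
    using that strict_monoD[OF assms[of j]] by (cases "e j \<bullet> x < e j \<bullet> y") (auto simp: zero_less_mult_iff)
  then have nn: "0 \<le> 2/3 * ((e j \<bullet> x - e j \<bullet> y) * (T j (e j \<bullet> x) - T j (e j \<bullet> y)))" for j
    by (cases "e j \<bullet> x = e j \<bullet> y") (auto simp: less_imp_le)
  have "2/3 * ((e j \<bullet> x - e j \<bullet> y) * (T j (e j \<bullet> x) - T j (e j \<bullet> y))) = 0" for j
    using z nn by (subst (asm) sum_nonneg_eq_0_iff) auto
  then have "e j \<bullet> x = e j \<bullet> y" for j using pos[of j] by fastforce
  then have "(\<Sum>j\<in>UNIV. (e j \<bullet> (x - y))\<^sup>2) = 0" by (simp add: inner_diff_right)
  then show False using ne by (simp add: tight_frame)
qed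

section \<open>The sharp geometric Brascamp--Lieb inequality\<close>

text \<open>The function that is called $H_f$ in the introduction.\<close>
definition geom_mean :: "(3 \<Rightarrow> real \<Rightarrow> real) \<Rightarrow> real^2 \<Rightarrow> real" where
  "geom_mean f x = (\<Prod>j\<in>UNIV. f j (e j \<bullet> x)) powr (1/3)"

lemma geom_mean_nonneg [simp]: "0 \<le> geom_mean f x"
  by (simp add: geom_mean_def)

lemma geom_mean_measurable [measurable]:
  assumes "\<And>j. f j \<in> borel_measurable borel"
  shows "geom_mean f \<in> borel_measurable borel"
  unfolding geom_mean_def using assms by measurable

text \<open>Let $T_j$ transport $f_j$ to the standard Gaussian density $\gamma$ and put
  $\Theta(x) = \frac23 \sum_j T_j(e_j \cdot x)\, e_j$.  Then $f_j = T_j' \cdot (\gamma \circ T_j)$, the product of the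
  $(T_j')^{2/3}$ is bounded by the Jacobian determinant of $\Theta$ (\<open>det_tripod_ge\<close>), and that of the
  $\gamma(T_j)^{2/3}$ by the Gaussian density of the plane at $\Theta(x)$ (\<open>norm_synthesis_le\<close>).  The change of variables $y = \Theta(x)$ finishes the proof.\<close>
lemma brascamp_lieb_densities:
  assumes cont: "\<And>j. continuous_on UNIV (f j)" and pos: "\<And>j s. 0 < f j s"
    and int: "\<And>j. (\<integral>\<^sup>+s. ennreal (f j s) \<partial>lborel) = 1"
  shows "(\<integral>\<^sup>+x. ennreal ((geom_mean f x)\<^sup>2) \<partial>lborel) \<le> 1"
proof -
  have "\<forall>j. \<exists>T T'. (\<forall>s. (T has_real_derivative T' s) (at s)) \<and> (\<forall>s. 0 < T' s) \<and>
      (\<forall>s. f j s = T' s * std_normal_density (T s))"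
  proof
    fix j
    have "continuous_on UNIV std_normal_density"
      unfolding std_normal_density_def by (intro continuous_intros) auto
    from transport_between_positive_densities[OF cont[of j] pos[of j] int[of j] this]
    show "\<exists>T T'. (\<forall>s. (T has_real_derivative T' s) (at s)) \<and> (\<forall>s. 0 < T' s) \<and>
      (\<forall>s. f j s = T' s * std_normal_density (T s))"
      by (metis nn_integral_std_normal normal_density_pos zero_less_one)
  qed
  then obtain T T' where der: "\<And>j s. (T j has_real_derivative T' j s) (at s)"
    and T': "\<And>j s. 0 < T' j s" and fT: "\<And>j s. f j s = T' j s * std_normal_density (T j s)"
    by metis
  define \<Theta> where "\<Theta> x = (\<Sum>j\<in>UNIV. (2/3 * T j (e j \<bullet> x)) *\<^sub>R e j)" for x
  define D where "D x h = (\<Sum>j\<in>UNIV. (2/3 * (T' j (e j \<bullet> x) * (e j \<bullet> h))) *\<^sub>R e j)" for x h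
  define \<Phi> :: "real^2 \<Rightarrow> real" where "\<Phi> y = 1 / (2 * pi) * exp (- (y \<bullet> y) / 2)" for y
  have dT: "(\<Theta> has_derivative D x) (at x)" for x
  proof -
    have "((\<lambda>x. T j (e j \<bullet> x)) has_derivative (\<lambda>h. T' j (e j \<bullet> x) * (e j \<bullet> h))) (at x)" for j
      using der[of j "e j \<bullet> x"] unfolding has_field_derivative_def
      by (rule has_derivative_compose[rotated]) (auto intro!: derivative_eq_intros)
    then show ?thesis unfolding \<Theta>_def D_def
      by (auto intro!: derivative_eq_intros simp: mult_ac)
  qed
  have "strict_mono (T j)" for j
    by (rule strict_monoI) (metis DERIV_pos_imp_increasing der T')
  then have inj: "inj \<Theta>" unfolding \<Theta>_def by (rule synthesis_inj)
  have \<Phi>int: "(\<integral>\<^sup>+y. ennreal (\<Phi> y) \<partial>lborel) = 1" unfolding \<Phi>_def by (rule std_normal_pair)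
  have \<Phi>0: "0 \<le> \<Phi> y" for y by (simp add: \<Phi>_def)
  have \<Phi>i: "integrable lborel \<Phi>"
  proof (rule integrableI_nonneg)
    show "\<Phi> \<in> borel_measurable lborel" unfolding \<Phi>_def by measurable
  qed (auto simp: \<Phi>0 \<Phi>int)
  have pw: "(geom_mean f x)\<^sup>2 \<le> \<bar>det (matrix (D x))\<bar> * \<Phi> (\<Theta> x)" for x
  proof -
    define c where "c j = T j (e j \<bullet> x)" for j
    have "geom_mean f x = ((\<Prod>j\<in>UNIV. T' j (e j \<bullet> x)) * (\<Prod>j\<in>UNIV. std_normal_density (c j))) powr (1/3)"
      by (simp add: geom_mean_def fT c_def prod.distrib)
    also have "\<dots> = (\<Prod>j\<in>UNIV. T' j (e j \<bullet> x)) powr (1/3) * (\<Prod>j\<in>UNIV. std_normal_density (c j)) powr (1/3)"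
      by (intro powr_mult)
    finally have g: "(geom_mean f x)\<^sup>2 = ((\<Prod>j\<in>UNIV. T' j (e j \<bullet> x)) powr (1/3))\<^sup>2
      * ((\<Prod>j\<in>UNIV. std_normal_density (c j)) powr (1/3))\<^sup>2" by (simp add: power_mult_distrib)
    have "((\<Prod>j\<in>UNIV. std_normal_density (c j)) powr (1/3))\<^sup>2
      = 1 / (2 * pi) * exp (- (\<Sum>j\<in>UNIV. (c j)\<^sup>2) / 3)"
    proof -
      have s: "1 / sqrt (2 * pi) = exp (- ln (2*pi) / 2)"
        by (simp add: exp_minus ln_sqrt[symmetric] field_simps)
      have i: "1 / (2 * pi) = exp (- ln (2*pi))" by (simp add: exp_minus field_simps)
      have "(\<Prod>j\<in>UNIV. std_normal_density (c j)) = exp (\<Sum>j\<in>UNIV. - ln (2*pi) / 2 + - (c j)\<^sup>2 / 2)"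
        by (simp add: exp_sum std_normal_density_def s flip: exp_add)
      also have "(\<Sum>j\<in>UNIV. - ln (2*pi) / 2 + - (c j)\<^sup>2 / 2) = - 3 * ln (2 * pi) / 2 - (\<Sum>j\<in>UNIV. (c j)\<^sup>2) / 2"
        by (simp add: sum_3 add_divide_distrib)
      finally show ?thesis unfolding i
        by (simp add: powr_def power2_eq_square field_simps flip: exp_add)
    qed
    also have "\<dots> \<le> \<Phi> (\<Theta> x)"
      using norm_synthesis_le[of c] unfolding \<Phi>_def \<Theta>_def c_def[symmetric]
      by (simp add: field_simps)
    finally show ?thesis unfolding g D_def
      by (intro mult_mono det_tripod_ge T') auto
  qed
  have "(\<integral>\<^sup>+x. ennreal ((geom_mean f x)\<^sup>2) \<partial>lborel)
    \<le> (\<integral>\<^sup>+x. ennreal (\<bar>det (matrix (D x))\<bar> * \<Phi> (\<Theta> x)) \<partial>lborel)"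
    by (intro nn_integral_mono ennreal_leI pw)
  also have "\<dots> \<le> (\<integral>\<^sup>+y. ennreal (\<Phi> y) \<partial>lborel)"
    by (rule nn_integral_change_of_variables_le[OF dT inj \<Phi>i \<Phi>0])
  finally show ?thesis by (simp add: \<Phi>int)
qed

text \<open>A null set of values of $e_j \cdot x$ is met only on a null set of lines.\<close>
lemma AE_inner_unit:
  assumes "AE s in lborel. P s"
  shows "AE x in lborel. P (e j \<bullet> x)"
proof -
  obtain N where N: "{s. \<not> P s} \<subseteq> N" "N \<in> null_sets lborel"
    using assms unfolding eventually_ae_filter by auto
  have [measurable]: "N \<in> sets borel" using N(2) by auto
  define v :: "real^2" where "v = vector [- (e j $ 2), e j $ 1]"
  have v: "norm v = 1" "e j \<bullet> v = 0"
    using sq_e[of j] by (simp_all add: v_def norm_eq_1 inner_vec_def sum_2 power2_eq_square)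
  have ee: "e j \<bullet> e j = 1" using norm_e by (simp add: norm_eq_1)
  have "(\<integral>\<^sup>+x. indicator N (e j \<bullet> x) \<partial>lborel) = (\<integral>\<^sup>+s. \<integral>\<^sup>+(t::real). indicator N s \<partial>lborel \<partial>lborel)"
    by (subst nn_integral_orthonormal_frame[OF norm_e v]) (auto simp: inner_add_right ee v)
  also have "\<dots> = (\<integral>\<^sup>+s. 0 \<partial>(lborel :: real measure))"
    using AE_not_in[OF N(2)] by (intro nn_integral_cong_AE) (auto elim!: eventually_mono)
  finally have "(\<integral>\<^sup>+x. indicator N (e j \<bullet> x) \<partial>lborel) = 0" by simp
  then have "AE x in lborel. indicator N (e j \<bullet> x) = (0::ennreal)"
    by (subst (asm) nn_integral_0_iff_AE) auto
  then show ?thesis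
    by eventually_elim (use N in \<open>auto simp: indicator_def split: if_splits\<close>)
qed

lemma geom_mean_mono:
  assumes "\<And>j. 0 \<le> f j (e j \<bullet> x)" "\<And>j. f j (e j \<bullet> x) \<le> g j (e j \<bullet> x)"
  shows "geom_mean f x \<le> geom_mean g x"
  unfolding geom_mean_def using assms by (intro powr_mono2 prod_mono prod_nonneg) auto

lemma geom_mean_scale:
  assumes "0 \<le> c"
  shows "geom_mean (\<lambda>j s. c * f j s) x = c * geom_mean f x"
proof -
  have "geom_mean (\<lambda>j s. c * f j s) x = (c ^ 3 * (\<Prod>j\<in>UNIV. f j (e j \<bullet> x))) powr (1/3)"
    by (simp add: geom_mean_def prod_3 power3_eq_cube mult_ac)
  also have "\<dots> = (c ^ 3) powr (1/3) * geom_mean f x"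
    by (simp add: powr_mult geom_mean_def)
  also have "(c ^ 3) powr (1/3) = c"
    using assms by (cases "c = 0") (simp_all add: powr_powr flip: powr_numeral)
  finally show ?thesis .
qed

lemma geom_mean_tendsto:
  assumes "\<And>n j s. 0 \<le> F n j s" "\<And>j. (\<lambda>n. F n j (e j \<bullet> x)) \<longlonglongrightarrow> f j (e j \<bullet> x)"
  shows "(\<lambda>n. geom_mean (F n) x) \<longlonglongrightarrow> geom_mean f x"
  unfolding geom_mean_def
proof (rule tendsto_powr')
  show "(\<lambda>n. \<Prod>j\<in>UNIV. F n j (e j \<bullet> x)) \<longlonglongrightarrow> (\<Prod>j\<in>UNIV. f j (e j \<bullet> x))"
    by (intro tendsto_prod assms)
qed (auto intro!: always_eventually prod_nonneg assms)

lemma geom_mean_tendsto_AE: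
  assumes "\<And>n j s. 0 \<le> F n j s" "\<And>j. AE s in lborel. (\<lambda>n. F n j s) \<longlonglongrightarrow> f j s"
  shows "AE x in lborel. (\<lambda>n. geom_mean (F n) x) \<longlonglongrightarrow> geom_mean f x"
proof -
  have "AE x in lborel. \<forall>j. (\<lambda>n. F n j (e j \<bullet> x)) \<longlonglongrightarrow> f j (e j \<bullet> x)"
    unfolding AE_all_countable using AE_inner_unit[OF assms(2)] by simp
  then show ?thesis by eventually_elim (intro geom_mean_tendsto assms, simp)
qed

lemma brascamp_lieb_continuous:
  assumes cont: "\<And>j. continuous_on UNIV (f j)" and pos: "\<And>j s. 0 < f j s"
    and int: "\<And>j. (\<integral>\<^sup>+s. ennreal (f j s) \<partial>lborel) \<le> ennreal c"
  shows "(\<integral>\<^sup>+x. ennreal ((geom_mean f x)\<^sup>2) \<partial>lborel) \<le> ennreal (c\<^sup>2)"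
proof -
  have [measurable]: "f j \<in> borel_measurable borel" for j
    using cont by (simp add: borel_measurable_continuous_onI)
  define I where "I j = enn2real (\<integral>\<^sup>+s. ennreal (f j s) \<partial>lborel)" for j
  have I: "(\<integral>\<^sup>+s. ennreal (f j s) \<partial>lborel) = ennreal (I j)" for j
    unfolding I_def using le_less_trans[OF int[of j] ennreal_less_top] by simp
  have "(\<integral>\<^sup>+s. ennreal (f j s) \<partial>lborel) \<noteq> 0" for j
  proof
    assume "(\<integral>\<^sup>+s. ennreal (f j s) \<partial>lborel) = 0"
    then have "AE s in (lborel :: real measure). False"
      by (subst (asm) nn_integral_0_iff_AE) (use pos[of j] in \<open>auto simp: ennreal_eq_0_iff not_le[symmetric]\<close>)
    then show False by (simp add: trivial_limit_def[symmetric] ae_filter_eq_bot_iff)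
  qed
  then have I0: "0 < I j" for j unfolding I by (simp add: ennreal_eq_0_iff not_le)
  have Ic: "I j \<le> c" for j using int[of j] I0[of j] unfolding I by (metis ennreal_le_iff2 not_le)
  have c: "0 \<le> c" using I0[of 1] Ic[of 1] by simp
  define g where "g j s = f j s / I j" for j s
  have g: "(\<integral>\<^sup>+x. ennreal ((geom_mean g x)\<^sup>2) \<partial>lborel) \<le> 1"
  proof (rule brascamp_lieb_densities)
    fix j
    show "continuous_on UNIV (g j)" unfolding g_def using I0[of j] by (intro continuous_intros cont) auto
    show "0 < g j s" for s unfolding g_def using I0 pos by simp
    have "(\<integral>\<^sup>+s. ennreal (g j s) \<partial>lborel) = (\<integral>\<^sup>+s. ennreal (f j s) * ennreal (1 / I j) \<partial>lborel)"
      unfolding g_def using I0[of j] pos[of j] by (intro nn_integral_cong) (simp add: ennreal_mult[symmetric] less_imp_le)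
    also have "\<dots> = 1"
      using I0[of j] by (simp add: nn_integral_multc I ennreal_mult[symmetric])
    finally show "(\<integral>\<^sup>+s. ennreal (g j s) \<partial>lborel) = 1" .
  qed
  have "geom_mean f x \<le> c * geom_mean g x" for x
    unfolding geom_mean_scale[OF c, symmetric]
  proof (rule geom_mean_mono)
    fix j show "0 \<le> f j (e j \<bullet> x)" using pos by (simp add: less_imp_le)
    show "f j (e j \<bullet> x) \<le> c * g j (e j \<bullet> x)"
      using mult_right_mono[OF Ic[of j] less_imp_le[OF pos[of j "e j \<bullet> x"]]] I0[of j] 
      by (simp add: g_def field_simps)
  qed
  then have "(geom_mean f x)\<^sup>2 \<le> c\<^sup>2 * (geom_mean g x)\<^sup>2" for x
    by (metis geom_mean_nonneg power_mono power_mult_distrib)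
  then have "(\<integral>\<^sup>+x. ennreal ((geom_mean f x)\<^sup>2) \<partial>lborel) \<le> (\<integral>\<^sup>+x. ennreal (c\<^sup>2) * ennreal ((geom_mean g x)\<^sup>2) \<partial>lborel)"
    by (intro nn_integral_mono) (simp add: ennreal_mult[symmetric] ennreal_leI)
  also have "\<dots> = ennreal (c\<^sup>2) * (\<integral>\<^sup>+x. ennreal ((geom_mean g x)\<^sup>2) \<partial>lborel)"
    by (intro nn_integral_cmult) (simp add: g_def[abs_def])
  also have "\<dots> \<le> ennreal (c\<^sup>2) * 1" by (intro mult_left_mono g) auto
  finally show ?thesis by simp
qed

text \<open>By Fatou's lemma the inequality passes to almost everywhere limits, provided that the integrals of the approximations do not exceed the bound $c$ in the limit.\<close>
lemma brascamp_lieb_limit: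
  assumes F: "\<And>n j. F n j \<in> borel_measurable borel" "\<And>n j s. 0 \<le> F n j s"
    and lim: "\<And>j. AE s in lborel. (\<lambda>n. F n j s) \<longlonglongrightarrow> f j s"
    and BL: "\<And>n c. (\<And>j. (\<integral>\<^sup>+s. ennreal (F n j s) \<partial>lborel) \<le> ennreal c) \<Longrightarrow> 0 \<le> c \<Longrightarrow>
        (\<integral>\<^sup>+x. ennreal ((geom_mean (F n) x)\<^sup>2) \<partial>lborel) \<le> ennreal (c\<^sup>2)"
    and int: "\<And>j \<epsilon>. 0 < \<epsilon> \<Longrightarrow> eventually (\<lambda>n. (\<integral>\<^sup>+s. ennreal (F n j s) \<partial>lborel) \<le> ennreal (c + \<epsilon>)) sequentially"
    and c: "0 \<le> c"
  shows "(\<integral>\<^sup>+x. ennreal ((geom_mean f x)\<^sup>2) \<partial>lborel) \<le> ennreal (c\<^sup>2)"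
proof -
  note [measurable] = F(1)
  have "(\<integral>\<^sup>+x. ennreal ((geom_mean f x)\<^sup>2) \<partial>lborel)
      = (\<integral>\<^sup>+x. liminf (\<lambda>n. ennreal ((geom_mean (F n) x)\<^sup>2)) \<partial>lborel)"
  proof (rule nn_integral_cong_AE, use geom_mean_tendsto_AE[OF F(2) lim] in eventually_elim)
    fix x assume "(\<lambda>n. geom_mean (F n) x) \<longlonglongrightarrow> geom_mean f x"
    then have "(\<lambda>n. ennreal ((geom_mean (F n) x)\<^sup>2)) \<longlonglongrightarrow> ennreal ((geom_mean f x)\<^sup>2)"
      by (intro tendsto_intros)
    then show "ennreal ((geom_mean f x)\<^sup>2) = liminf (\<lambda>n. ennreal ((geom_mean (F n) x)\<^sup>2))"
      by (intro lim_imp_Liminf[symmetric]) auto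
  qed
  also have "\<dots> \<le> liminf (\<lambda>n. \<integral>\<^sup>+x. ennreal ((geom_mean (F n) x)\<^sup>2) \<partial>lborel)"
    by (rule nn_integral_liminf) simp
  finally have fatou: "(\<integral>\<^sup>+x. ennreal ((geom_mean f x)\<^sup>2) \<partial>lborel) \<le> \<dots>" .
  have "(\<integral>\<^sup>+x. ennreal ((geom_mean f x)\<^sup>2) \<partial>lborel) \<le> ennreal ((c + \<epsilon>)\<^sup>2)" if "0 < \<epsilon>" for \<epsilon>
  proof -
    have "eventually (\<lambda>n. \<forall>j. (\<integral>\<^sup>+s. ennreal (F n j s) \<partial>lborel) \<le> ennreal (c + \<epsilon>)) sequentially"
      using int[OF that] by (intro eventually_all_finite) auto
    then have "eventually (\<lambda>n. (\<integral>\<^sup>+x. ennreal ((geom_mean (F n) x)\<^sup>2) \<partial>lborel) \<le> ennreal ((c + \<epsilon>)\<^sup>2)) sequentially"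
      by eventually_elim (rule BL, use c that in auto)
    then have "liminf (\<lambda>n. \<integral>\<^sup>+x. ennreal ((geom_mean (F n) x)\<^sup>2) \<partial>lborel) \<le> ennreal ((c + \<epsilon>)\<^sup>2)"
      by (intro Liminf_le) auto
    then show ?thesis using fatou by simp
  qed
  moreover have "((\<lambda>\<epsilon>. ennreal ((c + \<epsilon>)\<^sup>2)) \<longlongrightarrow> ennreal ((c + 0)\<^sup>2)) (at_right 0)"
    by (intro tendsto_intros)
  ultimately show ?thesis
    using tendsto_lowerbound[of "\<lambda>\<epsilon>. ennreal ((c + \<epsilon>)\<^sup>2)" _ "at_right 0"]
    by (auto simp: eventually_at_right_less eventually_at_filter)
qed

text \<open>A measurable function is an almost everywhere limit of continuous ones.  Clipping these to the range of $f_j$, cutting them off outside the support and adding a vanishing multiple of a Gaussian makes them positive and dominated, so that their integrals converge too.\<close>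
lemma brascamp_lieb_bounded:
  assumes f[measurable]: "\<And>j. f j \<in> borel_measurable borel" and f0: "\<And>j s. 0 \<le> f j s"
    and bd: "\<And>j s. f j s \<le> B" and supp: "\<And>j s. R < \<bar>s\<bar> \<Longrightarrow> f j s = 0"
    and int: "\<And>j. (\<integral>\<^sup>+s. ennreal (f j s) \<partial>lborel) \<le> ennreal c" and c: "0 \<le> c"
  shows "(\<integral>\<^sup>+x. ennreal ((geom_mean f x)\<^sup>2) \<partial>lborel) \<le> ennreal (c\<^sup>2)"
proof -
  have B: "0 \<le> B" using f0 bd order_trans by blast
  have "\<forall>j. \<exists>g. (\<forall>n. continuous_on UNIV (g n)) \<and> (AE s in lborel. (\<lambda>n. g n s) \<longlonglongrightarrow> f j s)"
  proof
    fix j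
    have "f j measurable_on UNIV"
      by (rule lebesgue_measurable_imp_measurable_on) (auto intro: measurable_completion)
    then obtain N g where N: "negligible N" and g: "\<And>n. continuous_on UNIV (g n)"
      and lim: "\<And>s. s \<notin> N \<Longrightarrow> (\<lambda>n. g n s) \<longlonglongrightarrow> f j s"
      unfolding measurable_on_def by auto
    have "AE s in lebesgue. s \<notin> N"
      using N by (simp add: negligible_iff_null_sets AE_not_in)
    then have "AE s in lebesgue. (\<lambda>n. g n s) \<longlonglongrightarrow> f j s"
      by eventually_elim (rule lim)
    with g show "\<exists>g. (\<forall>n. continuous_on UNIV (g n)) \<and> (AE s in lborel. (\<lambda>n. g n s) \<longlonglongrightarrow> f j s)"
      unfolding AE_completion_iff by blast
  qed
  then obtain g where g: "\<And>j n. continuous_on UNIV (g j n)"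
    and lim: "\<And>j. AE s in lborel. (\<lambda>n. g j n s) \<longlonglongrightarrow> f j s" by metis
  define cut :: "real \<Rightarrow> real" where "cut s = max 0 (min 1 (R + 1 - \<bar>s\<bar>))" for s
  have cut: "0 \<le> cut s" "cut s \<le> indicator {-R-1..R+1} s" "\<bar>s\<bar> \<le> R \<Longrightarrow> cut s = 1" for s
    by (auto simp: cut_def split: split_indicator)
  define F where "F n j s = min B (max 0 (g j n s)) * cut s + 1 / real (Suc n) * std_normal_density s" for n j s
  have Fc: "continuous_on UNIV (F n j)" for n j
    unfolding F_def cut_def std_normal_density_def by (intro continuous_intros g) auto
  have Fm[measurable]: "F n j \<in> borel_measurable borel" for n j
    using Fc by (simp add: borel_measurable_continuous_onI)
  have Fpos: "0 < F n j s" for n j s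
    unfolding F_def using B cut(1) by (intro add_nonneg_pos mult_nonneg_nonneg mult_pos_pos normal_density_pos) auto
  have Flim: "AE s in lborel. (\<lambda>n. F n j s) \<longlonglongrightarrow> f j s" for j
    using lim[of j]
  proof eventually_elim
    fix s assume "(\<lambda>n. g j n s) \<longlonglongrightarrow> f j s"
    then have "(\<lambda>n. F n j s) \<longlonglongrightarrow> min B (max 0 (f j s)) * cut s + 0 * std_normal_density s"
      unfolding F_def by (intro tendsto_intros LIMSEQ_Suc[OF lim_inverse_n'])
    also have "min B (max 0 (f j s)) * cut s + 0 * std_normal_density s = f j s"
      using f0[of j s] bd[of j s] supp[of s j] cut(3)[of s] by (cases "\<bar>s\<bar> \<le> R") auto
    finally show "(\<lambda>n. F n j s) \<longlonglongrightarrow> f j s" .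
  qed
  have FI: "(\<lambda>n. \<integral>\<^sup>+s. ennreal (F n j s) \<partial>lborel) \<longlonglongrightarrow> (\<integral>\<^sup>+s. ennreal (f j s) \<partial>lborel)" for j
  proof (rule nn_integral_dominated_convergence)
    let ?w = "\<lambda>s. ennreal B * indicator {-R-1..R+1} s + ennreal (std_normal_density s)"
    have "F n j s \<le> B * indicator {-R-1..R+1} s + std_normal_density s" for n s
      unfolding F_def using B cut[of s] by (intro add_mono mult_mono) (auto simp: field_simps)
    then have "ennreal (F n j s) \<le> ennreal (B * indicator {-R-1..R+1} s + std_normal_density s)" for n s
      by (intro ennreal_leI)
    also have "ennreal (B * indicator {-R-1..R+1} s + std_normal_density s) = ?w s" for s
      using B by (simp split: split_indicator)
    finally show "AE s in lborel. ennreal (F n j s) \<le> ?w s" for n by simp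
    have "(\<integral>\<^sup>+s. ?w s \<partial>lborel) = ennreal B * emeasure lborel {-R-1..R+1} + 1"
      by (simp add: nn_integral_add nn_integral_std_normal nn_integral_cmult)
    also have "\<dots> < \<infinity>"
      using emeasure_lborel_cbox_finite[of "-R-1" "R+1"] by (simp add: ennreal_mult_less_top)
    finally show "(\<integral>\<^sup>+s. ?w s \<partial>lborel) < \<infinity>" .
    show "AE s in lborel. (\<lambda>n. ennreal (F n j s)) \<longlonglongrightarrow> ennreal (f j s)"
      using Flim[of j] by eventually_elim (rule tendsto_ennrealI)
  qed auto
  show ?thesis
  proof (rule brascamp_lieb_limit[OF Fm less_imp_le[OF Fpos] Flim])
    show "(\<integral>\<^sup>+x. ennreal ((geom_mean (F n) x)\<^sup>2) \<partial>lborel) \<le> ennreal (b\<^sup>2)"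
      if "\<And>j. (\<integral>\<^sup>+s. ennreal (F n j s) \<partial>lborel) \<le> ennreal b" "0 \<le> b" for n b
      by (rule brascamp_lieb_continuous[OF Fc Fpos that(1)])
    fix j and \<epsilon> :: real assume "0 < \<epsilon>"
    then have "(\<integral>\<^sup>+s. ennreal (f j s) \<partial>lborel) < ennreal (c + \<epsilon>)"
      using int[of j] c by (auto elim!: le_less_trans simp: ennreal_less_iff)
    from order_tendstoD(2)[OF FI this]
    show "eventually (\<lambda>n. (\<integral>\<^sup>+s. ennreal (F n j s) \<partial>lborel) \<le> ennreal (c + \<epsilon>)) sequentially"
      by eventually_elim simp
  qed (rule c)
qed

text \<open>Truncation in height and in space reduces the general case to bounded functions with bounded support.\<close>
theorem brascamp_lieb:
  assumes f[measurable]: "\<And>j. f j \<in> borel_measurable borel" and f0: "\<And>j s. 0 \<le> f j s"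
    and int: "\<And>j. (\<integral>\<^sup>+s. ennreal (f j s) \<partial>lborel) \<le> ennreal c" and c: "0 \<le> c"
  shows "(\<integral>\<^sup>+x. ennreal ((geom_mean f x)\<^sup>2) \<partial>lborel) \<le> ennreal (c\<^sup>2)"
proof -
  define F where "F n j s = min (real n) (f j s) * indicator {- real n..real n} s" for n j s
  have F[measurable]: "F n j \<in> borel_measurable borel" for n j unfolding F_def by measurable
  have F0: "0 \<le> F n j s" for n j s by (simp add: F_def f0)
  have lim: "(\<lambda>n. F n j s) \<longlonglongrightarrow> f j s" for j s
  proof (rule tendsto_eventually)
    have "eventually (\<lambda>n. f j s \<le> real n) sequentially" "eventually (\<lambda>n. \<bar>s\<bar> \<le> real n) sequentially"
      using filterlim_real_sequentially by (simp_all add: filterlim_at_top)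
    then show "eventually (\<lambda>n. F n j s = f j s) sequentially"
      by eventually_elim (auto simp: F_def indicator_def)
  qed
  have le: "F n j s \<le> f j s" for n j s using f0[of j s] by (simp add: F_def split: split_indicator)
  show ?thesis
  proof (rule brascamp_lieb_limit[OF F F0])
    show "AE s in lborel. (\<lambda>n. F n j s) \<longlonglongrightarrow> f j s" for j using lim by simp
    show "(\<integral>\<^sup>+x. ennreal ((geom_mean (F n) x)\<^sup>2) \<partial>lborel) \<le> ennreal (b\<^sup>2)"
      if "\<And>j. (\<integral>\<^sup>+s. ennreal (F n j s) \<partial>lborel) \<le> ennreal b" "0 \<le> b" for n b
    proof (rule brascamp_lieb_bounded[where B="real n" and R="real n", OF F F0 _ _ that])
      show "F n j s \<le> real n" for j s by (simp add: F_def split: split_indicator)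
      show "real n < \<bar>s\<bar> \<Longrightarrow> F n j s = 0" for j s by (auto simp: F_def split: split_indicator)
    qed
    fix j and \<epsilon> :: real assume "0 < \<epsilon>"
    have "(\<integral>\<^sup>+s. ennreal (F n j s) \<partial>lborel) \<le> ennreal (c + \<epsilon>)" for n
    proof -
      have "(\<integral>\<^sup>+s. ennreal (F n j s) \<partial>lborel) \<le> (\<integral>\<^sup>+s. ennreal (f j s) \<partial>lborel)"
        by (intro nn_integral_mono ennreal_leI le)
      also have "\<dots> \<le> ennreal c" by (rule int)
      also have "\<dots> \<le> ennreal (c + \<epsilon>)" using \<open>0 < \<epsilon>\<close> by (intro ennreal_leI) simp
      finally show ?thesis .
    qed
    then show "eventually (\<lambda>n. (\<integral>\<^sup>+s. ennreal (F n j s) \<partial>lborel) \<le> ennreal (c + \<epsilon>)) sequentially" by simp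
  qed (rule c)
qed

end

section \<open>Almost everywhere convergence by strict convexity\<close>

text \<open>This is a substitute for weak compactness in $L^1$.  Choose $f_n \in S_n$ that nearly minimises the strictly convex
  functional $\Psi(f) = \sum_i \int e^{-f_i}$ over $S_n$.  The midpoint of $f_n$ and $f_m$ cannot do much
  better than either, and the gap in the convexity inequality is a square:
  $\Psi(f_n) + \Psi(f_m) - 2 \Psi((f_n + f_m)/2) = \sum_i \int (e^{-f_{n,i}/2} - e^{-f_{m,i}/2})^2$.
  So the functions $e^{-f_n/2}$ form a Cauchy sequence in $L^2$, and a subsequence converges almost everywhere.
  The exponential admits the value $\infty$ as a limit of $f_n$; a bound on integrals excludes it afterwards.\<close>
lemma convex_selection:
  fixes S :: "nat \<Rightarrow> ('i::finite \<Rightarrow> 'a \<Rightarrow> real) set"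
  assumes "prob_space M"
    and meas: "\<And>n f i. f \<in> S n \<Longrightarrow> f i \<in> borel_measurable M"
    and nonneg: "\<And>n f i x. f \<in> S n \<Longrightarrow> 0 \<le> f i x"
    and dec: "\<And>m n. m \<le> n \<Longrightarrow> S n \<subseteq> S m"
    and ne: "\<And>n. S n \<noteq> {}"
    and mid: "\<And>n f g. f \<in> S n \<Longrightarrow> g \<in> S n \<Longrightarrow> (\<lambda>i x. (f i x + g i x) / 2) \<in> S n"
  obtains F where "\<And>n. F n \<in> S n" "\<And>i. AE x in M. convergent (\<lambda>n. exp (- F n i x / 2))"
proof -
  interpret prob_space M by fact
  define \<Psi> where "\<Psi> f = (\<Sum>i\<in>UNIV. LINT x|M. exp (- f i x))" for f :: "'i \<Rightarrow> 'a \<Rightarrow> real"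
  have int: "integrable M (\<lambda>x. exp (- f i x))" if "f \<in> S n" for f n i
    using meas[OF that] nonneg[OF that] by (intro integrable_const_bound[where B=1]) auto
  have \<Psi>0: "0 \<le> \<Psi> f" for f unfolding \<Psi>_def by (intro sum_nonneg integral_nonneg) simp
  define a where "a n = (INF f\<in>S n. \<Psi> f)" for n
  have bdd: "bdd_below (\<Psi> ` S n)" for n by (rule bdd_belowI2[of _ 0]) (rule \<Psi>0)
  have a_le: "a n \<le> \<Psi> f" if "f \<in> S n" for f n
    unfolding a_def using bdd that by (rule cINF_lower)
  have inc: "a m \<le> a n" if "m \<le> n" for m n
    unfolding a_def by (rule cINF_superset_mono[OF ne bdd dec[OF that]]) simp
  have a1: "a n \<le> real CARD('i)" for n
  proof -
    obtain f where f: "f \<in> S n" using ne by auto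
    have "\<Psi> f \<le> (\<Sum>i\<in>(UNIV::'i set). LINT x|M. 1)"
      unfolding \<Psi>_def using nonneg[OF f] by (intro sum_mono integral_mono int[OF f]) auto
    then show ?thesis using a_le[OF f] by (simp add: prob_space)
  qed
  have "incseq a" using inc by (auto simp: incseq_def)
  then obtain L where "a \<longlonglongrightarrow> L" using incseq_convergent[of a "real CARD('i)"] a1 by blast
  then have cau: "Cauchy a" by (rule LIMSEQ_imp_Cauchy)
  have "\<exists>f\<in>S n. \<Psi> f < a n + 1 / real (Suc n)" for n
    using cINF_less_iff[OF ne bdd, of n "a n + 1 / real (Suc n)"] unfolding a_def[symmetric] by simp
  then obtain f where fS: "\<And>n. f n \<in> S n" and f\<Psi>: "\<And>n. \<Psi> (f n) < a n + 1 / real (Suc n)"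
    by metis
  note [measurable] = meas[OF fS]
  \<comment> \<open>Collecting the components in one vector yields a subsequence that serves all of them.\<close>
  define h :: "nat \<Rightarrow> 'a \<Rightarrow> real^'i" where "h n x = (\<chi> i. exp (- f n i x / 2))" for n x
  have h_meas[measurable]: "h n \<in> borel_measurable M" for n
    by (subst borel_measurable_euclidean_space) (auto simp: Basis_vec_def inner_axis h_def)
  have sq: "(exp (- a / 2) - exp (- b / 2))\<^sup>2 = exp (- a) + exp (- b) - 2 * exp (- ((a + b) / 2))" for a b :: real
  proof -
    have "(exp (- a / 2))\<^sup>2 = exp (- a)" "(exp (- b / 2))\<^sup>2 = exp (- b)"
      by (simp_all add: power2_eq_square flip: exp_add)
    moreover have "exp (- a / 2) * exp (- b / 2) = exp (- ((a + b) / 2))"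
      unfolding exp_add[symmetric] by (rule arg_cong[where f=exp]) (simp add: field_simps)
    ultimately show ?thesis unfolding power2_diff by simp
  qed
  have hc: "norm (h n x - h m x) ^ 2 = (\<Sum>i\<in>UNIV. exp (- f n i x) + exp (- f m i x) - 2 * exp (- ((f n i x + f m i x) / 2)))" for n m x
  proof -
    have "norm (h n x - h m x) ^ 2 = (\<Sum>i\<in>UNIV. (exp (- f n i x / 2) - exp (- f m i x / 2))\<^sup>2)"
      unfolding power2_norm_eq_inner by (simp add: inner_vec_def h_def power2_eq_square)
    also have "\<dots> = (\<Sum>i\<in>UNIV. exp (- f n i x) + exp (- f m i x) - 2 * exp (- ((f n i x + f m i x) / 2)))"
      by (intro sum.cong refl) (rule sq)
    finally show ?thesis .
  qed
  have E: "(LINT x|M. norm (h n x - h m x) ^ 2) \<le> (a n - a N) + (a m - a N) + 2 / real (Suc N)"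
    and Ei: "integrable M (\<lambda>x. norm (h n x - h m x) ^ 2)" if "N \<le> n" "N \<le> m" for n m N
  proof -
    have nm: "f n \<in> S N" "f m \<in> S N" using fS dec that by blast+
    define g where "g i x = (f n i x + f m i x) / 2" for i x
    have g: "g \<in> S N" unfolding g_def[abs_def] by (rule mid[OF nm])
    have I: "integrable M (\<lambda>x. exp (- f n i x))" "integrable M (\<lambda>x. exp (- f m i x))"
        "integrable M (\<lambda>x. exp (- ((f n i x + f m i x) / 2)))" for i
      using int[OF nm(1)] int[OF nm(2)] int[OF g] by (auto simp: g_def)
    show "integrable M (\<lambda>x. norm (h n x - h m x) ^ 2)"
      unfolding hc by (intro Bochner_Integration.integrable_sum Bochner_Integration.integrable_diff
        Bochner_Integration.integrable_add integrable_mult_right I)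
    have "(LINT x|M. norm (h n x - h m x) ^ 2) = \<Psi> (f n) + \<Psi> (f m) - 2 * \<Psi> g"
      unfolding hc \<Psi>_def g_def
      by (subst Bochner_Integration.integral_sum) (simp_all add: I sum.distrib sum_subtractf sum_distrib_left)
    also have "\<dots> \<le> (a n + 1 / real (Suc n)) + (a m + 1 / real (Suc m)) - 2 * a N"
      using f\<Psi>[of n] f\<Psi>[of m] a_le[OF g] by linarith
    also have "\<dots> \<le> (a n + 1 / real (Suc N)) + (a m + 1 / real (Suc N)) - 2 * a N"
      using that by (intro diff_right_mono add_mono order_refl divide_left_mono) auto
    finally show "(LINT x|M. norm (h n x - h m x) ^ 2) \<le> (a n - a N) + (a m - a N) + 2 / real (Suc N)"
      by simp
  qed
  have h_bd: "norm (h n x) \<le> real CARD('i)" for n x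
  proof -
    have "norm (h n x) \<le> (\<Sum>i\<in>UNIV. \<bar>h n x $ i\<bar>)" by (rule norm_le_l1_cart)
    also have "\<dots> \<le> (\<Sum>i\<in>(UNIV::'i set). 1)"
      using nonneg[OF fS] by (intro sum_mono) (simp add: h_def)
    finally show ?thesis by simp
  qed
  have h_int: "integrable M (h n)" for n
    by (rule integrable_const_bound[where B="real CARD('i)"]) (auto simp: h_bd)
  obtain r where r: "strict_mono r" "AE x in M. Cauchy (\<lambda>n. h (r n) x)"
  proof (rule cauchy_L1_AE_cauchy_subseq[OF h_int])
    fix \<epsilon> :: real assume "0 < \<epsilon>"
    have \<epsilon>2: "0 < \<epsilon>\<^sup>2 / 4" using \<open>0 < \<epsilon>\<close> by simp
    obtain N1 where N1: "\<And>m n. N1 \<le> m \<Longrightarrow> N1 \<le> n \<Longrightarrow> dist (a m) (a n) < \<epsilon>\<^sup>2 / 4"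
      using metric_CauchyD[OF cau \<epsilon>2] by blast
    obtain N2 where N2: "2 / \<epsilon>\<^sup>2 * 4 < real N2" using reals_Archimedean2 by blast
    define N where "N = max N1 N2"
    have N: "2 / real (Suc N) < \<epsilon>\<^sup>2 / 4"
    proof -
      have "2 / \<epsilon>\<^sup>2 * 4 < real (Suc N)" using N2 by (simp add: N_def)
      then show ?thesis using \<open>0 < \<epsilon>\<close> by (simp add: field_simps)
    qed
    have "LINT x|M. norm (h i x - h j x) < \<epsilon>" if "N \<le> i" "N \<le> j" for i j
    proof -
      have ai: "a i - a N < \<epsilon>\<^sup>2 / 4" "a j - a N < \<epsilon>\<^sup>2 / 4"
      proof -
        have "N1 \<le> N" by (simp add: N_def)
        then have "\<bar>a i - a N\<bar> < \<epsilon>\<^sup>2 / 4" "\<bar>a j - a N\<bar> < \<epsilon>\<^sup>2 / 4"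
          using N1[of i N] N1[of j N] that by (simp_all add: dist_real_def)
        then show "a i - a N < \<epsilon>\<^sup>2 / 4" "a j - a N < \<epsilon>\<^sup>2 / 4" by linarith+
      qed
      have e: "(LINT x|M. norm (h i x - h j x) ^ 2) < \<epsilon>\<^sup>2"
        using E[OF that] ai N \<epsilon>2 by linarith
      \<comment> \<open>On a probability space, smallness in $L^2$ gives smallness in $L^1$.\<close>
      have pw: "norm (h i x - h j x) \<le> \<epsilon> / 2 + norm (h i x - h j x) ^ 2 / (2 * \<epsilon>)" for x
        using sum_squares_bound[of \<epsilon> "norm (h i x - h j x)"] \<open>0 < \<epsilon>\<close>
        by (simp add: field_simps power2_eq_square)
      have "(LINT x|M. norm (h i x - h j x)) \<le> (LINT x|M. \<epsilon> / 2 + norm (h i x - h j x) ^ 2 / (2 * \<epsilon>))"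
        by (intro integral_mono pw integrable_norm Bochner_Integration.integrable_diff h_int
            Bochner_Integration.integrable_add integrable_divide Ei[OF that]) auto
      also have "\<dots> = \<epsilon> / 2 + (LINT x|M. norm (h i x - h j x) ^ 2) / (2 * \<epsilon>)"
        using Ei[OF that] by (subst Bochner_Integration.integral_add) (auto simp: prob_space)
      also have "\<dots> < \<epsilon> / 2 + \<epsilon>\<^sup>2 / (2 * \<epsilon>)"
        using e \<open>0 < \<epsilon>\<close> by (intro add_strict_left_mono divide_strict_right_mono) auto
      also have "\<dots> = \<epsilon>" using \<open>0 < \<epsilon>\<close> by (simp add: power2_eq_square)
      finally show ?thesis .
    qed
    then show "\<exists>N. \<forall>i\<ge>N. \<forall>j\<ge>N. LINT x|M. norm (h i x - h j x) < \<epsilon>" by blast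
  qed auto
  show ?thesis
  proof
    show "f (r n) \<in> S n" for n using fS dec[OF seq_suble[OF r(1)]] by blast
    show "AE x in M. convergent (\<lambda>n. exp (- f (r n) i x / 2))" for i
      using r(2)
    proof eventually_elim
      fix x assume "Cauchy (\<lambda>n. h (r n) x)"
      then obtain l where "(\<lambda>n. h (r n) x) \<longlonglongrightarrow> l" using Cauchy_convergent convergentD by blast
      from tendsto_vec_nth[OF this, of i] show "convergent (\<lambda>n. exp (- f (r n) i x / 2))"
        by (auto simp: h_def convergent_def)
    qed
  qed
qed

section \<open>Existence of maximisers\<close>

context tripod begin

text \<open>The floor $p$ is either $0$ or a small positive function; the constraint bounds the mass above the floor, so that scaling $f_j - p$ down preserves admissibility.\<close>
definition admissible :: "(real \<Rightarrow> real) \<Rightarrow> (3 \<Rightarrow> real \<Rightarrow> real) set" where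
  "admissible p = {f. \<forall>j. f j \<in> borel_measurable borel \<and> (\<forall>s. p s \<le> f j s) \<and>
      (\<integral>\<^sup>+s. ennreal (f j s - p s) \<partial>lborel) \<le> 1}"

definition pairing :: "(real^2 \<Rightarrow> real) \<Rightarrow> (3 \<Rightarrow> real \<Rightarrow> real) \<Rightarrow> ennreal" where
  "pairing G f = (\<integral>\<^sup>+x. ennreal (G x * geom_mean f x) \<partial>lborel)"

text \<open>Only the coordinate $j$ is rescaled when one function of a triple is varied; the cube compensates the exponent $1/3$.\<close>
lemma geom_mean_ge:
  assumes "0 \<le> c" "\<And>i. 0 \<le> f i (e i \<bullet> x)" "\<And>i. i \<noteq> j \<Longrightarrow> f i (e i \<bullet> x) \<le> g i (e i \<bullet> x)"
    and "c ^ 3 * f j (e j \<bullet> x) \<le> g j (e j \<bullet> x)"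
  shows "c * geom_mean f x \<le> geom_mean g x"
proof -
  have c: "(c ^ 3) powr (1/3) = c"
    using assms(1) by (cases "c = 0") (simp_all add: powr_powr flip: powr_numeral)
  have "c ^ 3 * (\<Prod>i\<in>UNIV. f i (e i \<bullet> x))
      = (c ^ 3 * f j (e j \<bullet> x)) * (\<Prod>i\<in>UNIV - {j}. f i (e i \<bullet> x))"
    by (simp add: prod.remove[of UNIV j])
  also have "\<dots> \<le> g j (e j \<bullet> x) * (\<Prod>i\<in>UNIV - {j}. g i (e i \<bullet> x))"
    using assms by (intro mult_mono prod_mono prod_nonneg order_trans[OF _ assms(4)]) auto
  also have "\<dots> = (\<Prod>i\<in>UNIV. g i (e i \<bullet> x))" by (simp add: prod.remove[of UNIV j])
  finally have "(c ^ 3 * (\<Prod>i\<in>UNIV. f i (e i \<bullet> x))) powr (1/3) \<le> geom_mean g x"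
    unfolding geom_mean_def using assms by (intro powr_mono2) (auto intro!: mult_nonneg_nonneg prod_nonneg)
  then show ?thesis by (simp add: powr_mult c geom_mean_def)
qed

text \<open>After division by the geometric mean of the midpoint, both terms on the left are bounded by arithmetic means, which add up to $2$.\<close>
lemma geom_mean_concave:
  assumes f: "\<And>j. 0 \<le> f j (e j \<bullet> x)" and g: "\<And>j. 0 \<le> g j (e j \<bullet> x)"
  shows "(geom_mean f x + geom_mean g x) / 2 \<le> geom_mean (\<lambda>j s. (f j s + g j s) / 2) x"
proof -
  define a where "a j = f j (e j \<bullet> x)" for j
  define b where "b j = g j (e j \<bullet> x)" for j
  define c where "c j = (a j + b j) / 2" for j
  note nn = f[folded a_def] g[folded b_def]
  show ?thesis
  proof (cases "\<exists>j. c j = 0")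
    case True
    then obtain j where "a j = 0" "b j = 0" using nn by (force simp: c_def add_nonneg_eq_0_iff)
    then have "(\<Prod>j\<in>UNIV. a j) = 0" "(\<Prod>j\<in>UNIV. b j) = 0" by auto
    then have "geom_mean f x = 0" "geom_mean g x = 0"
      unfolding geom_mean_def a_def[symmetric] b_def[symmetric] by simp_all
    then show ?thesis by simp
  next
    case False
    then have c: "0 < c j" for j using nn by (simp add: c_def less_le)
    let ?C = "(\<Prod>j\<in>UNIV. c j) powr (1/3)"
    have split: "(\<Prod>j\<in>UNIV. d j) powr (1/3) = ?C * (\<Prod>j\<in>UNIV. d j / c j) powr (1/3)" for d
    proof -
      have "(\<Prod>j\<in>UNIV. d j) = (\<Prod>j\<in>UNIV. c j) * (\<Prod>j\<in>UNIV. d j / c j)"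
        using c by (subst prod.distrib[symmetric]) (auto intro!: prod.cong simp: less_imp_neq[symmetric])
      then show ?thesis by (simp add: powr_mult)
    qed
    have "(\<Prod>j\<in>UNIV. a j / c j) powr (1/3) + (\<Prod>j\<in>UNIV. b j / c j) powr (1/3)
        \<le> (\<Sum>j\<in>UNIV. a j / c j) / 3 + (\<Sum>j\<in>UNIV. b j / c j) / 3"
      using nn c by (intro add_mono AM_GM_3 divide_nonneg_pos) auto
    also have "\<dots> = (\<Sum>j\<in>(UNIV::3 set). (a j + b j) / c j) / 3"
      by (simp add: sum.distrib add_divide_distrib)
    also have "(\<Sum>j\<in>(UNIV::3 set). (a j + b j) / c j) = (\<Sum>j\<in>(UNIV::3 set). 2)"
    proof (intro sum.cong refl)
      show "(a j + b j) / c j = 2" for j using c[of j] by (simp add: c_def divide_eq_eq)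
    qed
    finally have "?C * ((\<Prod>j\<in>UNIV. a j / c j) powr (1/3) + (\<Prod>j\<in>UNIV. b j / c j) powr (1/3)) \<le> ?C * 2"
      by (intro mult_left_mono) auto
    then show ?thesis
      unfolding geom_mean_def a_def[symmetric] b_def[symmetric] split[of a] split[of b]
      by (simp add: c_def algebra_simps)
  qed
qed

end

text \<open>The extremal problem for $G$ with floor $p$, where $N$ is the $L^2$ norm of $G$ and $D$ is the mass of the floor.\<close>
locale factorisation_problem = tripod +
  fixes G :: "real^2 \<Rightarrow> real" and N :: real and p :: "real \<Rightarrow> real" and D :: real
  assumes G_meas[measurable]: "G \<in> borel_measurable borel" and G0: "\<And>x. 0 \<le> G x"
    and G_int: "(\<integral>\<^sup>+x. ennreal ((G x)\<^sup>2) \<partial>lborel) = ennreal (N\<^sup>2)" and N0: "0 \<le> N"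
    and p_meas[measurable]: "p \<in> borel_measurable borel" and p0: "\<And>s. 0 \<le> p s"
    and p_int: "(\<integral>\<^sup>+s. ennreal (p s) \<partial>lborel) = ennreal D" and D0: "0 \<le> D"
begin

lemma admissible_nonneg: "f \<in> admissible p \<Longrightarrow> 0 \<le> f j s"
  using p0[of s] unfolding admissible_def by (auto intro: order_trans)

lemma admissible_measurable: "f \<in> admissible p \<Longrightarrow> f j \<in> borel_measurable borel"
  unfolding admissible_def by auto

lemma admissible_integral:
  assumes f: "f \<in> admissible p"
  shows "(\<integral>\<^sup>+s. ennreal (f j s) \<partial>lborel) \<le> ennreal (1 + D)"
proof -
  note [measurable] = admissible_measurable[OF f]
  have "(\<integral>\<^sup>+s. ennreal (f j s) \<partial>lborel) = (\<integral>\<^sup>+s. ennreal (f j s - p s) + ennreal (p s) \<partial>lborel)"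
    using f p0 by (intro nn_integral_cong) (auto simp: admissible_def simp flip: ennreal_plus)
  also have "\<dots> = (\<integral>\<^sup>+s. ennreal (f j s - p s) \<partial>lborel) + ennreal D"
    by (simp add: nn_integral_add p_int)
  also have "\<dots> \<le> 1 + ennreal D" using f by (intro add_right_mono) (auto simp: admissible_def)
  finally show ?thesis using D0 by simp
qed

lemma admissible_midpoint:
  assumes f: "f \<in> admissible p" and g: "g \<in> admissible p"
  shows "(\<lambda>j s. (f j s + g j s) / 2) \<in> admissible p"
  unfolding admissible_def
proof (intro CollectI allI conjI)
  fix j
  note [measurable] = admissible_measurable[OF f] admissible_measurable[OF g]
  show "(\<lambda>s. (f j s + g j s) / 2) \<in> borel_measurable borel" by measurable
  have fg: "p s \<le> f j s" "p s \<le> g j s" for s using f g by (auto simp: admissible_def)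
  show "p s \<le> (f j s + g j s) / 2" for s using fg[of s] by simp
  have "(\<integral>\<^sup>+s. ennreal ((f j s + g j s) / 2 - p s) \<partial>lborel)
      = (\<integral>\<^sup>+s. ennreal (1/2) * (ennreal (f j s - p s) + ennreal (g j s - p s)) \<partial>lborel)"
  proof (intro nn_integral_cong)
    fix s
    have "ennreal ((f j s + g j s) / 2 - p s) = ennreal (1/2 * ((f j s - p s) + (g j s - p s)))"
      by (simp add: field_simps)
    also have "\<dots> = ennreal (1/2) * (ennreal (f j s - p s) + ennreal (g j s - p s))"
      using fg[of s] by (simp only: ennreal_mult ennreal_plus diff_ge_0_iff_ge add_nonneg_nonneg)
    finally show "ennreal ((f j s + g j s) / 2 - p s) = ennreal (1/2) * (ennreal (f j s - p s) + ennreal (g j s - p s))" .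
  qed
  also have "\<dots> = ennreal (1/2) * ((\<integral>\<^sup>+s. ennreal (f j s - p s) \<partial>lborel) + (\<integral>\<^sup>+s. ennreal (g j s - p s) \<partial>lborel))"
    by (simp add: nn_integral_cmult nn_integral_add)
  also have "\<dots> \<le> ennreal (1/2) * (1 + 1)"
    using f g by (intro mult_left_mono add_mono) (auto simp: admissible_def)
  also have "\<dots> = ennreal (1/2 * (1 + 1))" by (subst ennreal_mult) (auto simp flip: ennreal_plus ennreal_1)
  finally show "(\<integral>\<^sup>+s. ennreal ((f j s + g j s) / 2 - p s) \<partial>lborel) \<le> 1" by simp
qed

lemma geom_mean_L2:
  assumes f: "f \<in> admissible p"
  shows "(\<integral>\<^sup>+x. ennreal ((geom_mean f x)\<^sup>2) \<partial>lborel) \<le> ennreal ((1 + D)\<^sup>2)"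
  by (rule brascamp_lieb[OF admissible_measurable[OF f] admissible_nonneg[OF f] admissible_integral[OF f]])
     (use D0 in simp)

text \<open>Cauchy--Schwarz, with the Brascamp--Lieb inequality as the bound for the second factor.\<close>
lemma pairing_le:
  assumes f: "f \<in> admissible p"
  shows "pairing G f \<le> ennreal (N * (1 + D))"
proof -
  note [measurable] = admissible_measurable[OF f]
  have "(pairing G f)\<^sup>2 = (\<integral>\<^sup>+x. ennreal (G x) * ennreal (geom_mean f x) \<partial>lborel)\<^sup>2"
    unfolding pairing_def by (simp add: ennreal_mult G0)
  also have "\<dots> \<le> (\<integral>\<^sup>+x. (ennreal (G x))\<^sup>2 \<partial>lborel) * (\<integral>\<^sup>+x. (ennreal (geom_mean f x))\<^sup>2 \<partial>lborel)"
    by (rule Cauchy_Schwarz_nn_integral) measurable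
  also have "\<dots> \<le> ennreal (N\<^sup>2) * ennreal ((1 + D)\<^sup>2)"
    using geom_mean_L2[OF f] by (intro mult_mono) (simp_all add: ennreal_power G0 G_int)
  also have "\<dots> = ennreal ((N * (1 + D))\<^sup>2)" by (simp add: ennreal_mult power_mult_distrib)
  finally have le: "(pairing G f)\<^sup>2 \<le> ennreal ((N * (1 + D))\<^sup>2)" .
  show ?thesis
  proof (cases "pairing G f")
    case (real r)
    then have "r\<^sup>2 \<le> (N * (1 + D))\<^sup>2" using le by (simp add: ennreal_power)
    then have "r \<le> N * (1 + D)" by (rule power2_le_imp_le) (use N0 D0 in simp)
    then show ?thesis using real by (simp add: ennreal_leI)
  next
    case top then show ?thesis using le by (simp add: power2_eq_square ennreal_mult_top top_unique)
  qed
qed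

text \<open>Weak convergence in $L^2$ without reference to weak topologies: the part of $G H$ where $H \le K G$ is dominated by
  $K G^2$, and the rest is at most $H^2 / K$, hence has integral at most $(1 + D)^2 / K$ uniformly in the sequence.\<close>
lemma pairing_limit:
  assumes F: "\<And>n. F n \<in> admissible p" and f: "f \<in> admissible p"
    and lim: "\<And>j. AE s in lborel. (\<lambda>n. F n j s) \<longlonglongrightarrow> f j s"
    and M: "\<And>n. M \<le> pairing G (F n) + ennreal (1 / real (Suc n))"
  shows "M \<le> pairing G f"
proof -
  note [measurable] = admissible_measurable[OF f] admissible_measurable[OF F]
  have bd: "M \<le> pairing G f + ennreal ((1 + D)\<^sup>2 / K)" if K: "0 < K" for K :: real
  proof -
    let ?A = "\<lambda>g. \<integral>\<^sup>+x. ennreal (min (G x * geom_mean g x) (K * (G x)\<^sup>2)) \<partial>lborel"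
    have "pairing G (F n) \<le> ?A (F n) + ennreal ((1 + D)\<^sup>2 / K)" for n
    proof -
      have pw: "G x * geom_mean (F n) x \<le> min (G x * geom_mean (F n) x) (K * (G x)\<^sup>2) + 1 / K * (geom_mean (F n) x)\<^sup>2" for x
      proof (cases "G x * geom_mean (F n) x \<le> K * (G x)\<^sup>2")
        case False
        then have "G x * (K * G x) < G x * geom_mean (F n) x" by (simp add: power2_eq_square mult_ac)
        then have "K * G x < geom_mean (F n) x" using G0[of x] by (simp add: mult_less_cancel_left)
        then have "K * G x * geom_mean (F n) x \<le> (geom_mean (F n) x)\<^sup>2"
          by (simp add: power2_eq_square mult_right_mono)
        then have "G x * geom_mean (F n) x \<le> 1 / K * (geom_mean (F n) x)\<^sup>2" using K by (simp add: field_simps)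
        moreover have "0 \<le> K * (G x)\<^sup>2" using K by simp
        ultimately show ?thesis using False by simp
      qed (use K in simp)
      have "pairing G (F n) \<le> (\<integral>\<^sup>+x. ennreal (min (G x * geom_mean (F n) x) (K * (G x)\<^sup>2))
          + ennreal (1 / K) * ennreal ((geom_mean (F n) x)\<^sup>2) \<partial>lborel)"
        unfolding pairing_def
        using K pw G0 by (intro nn_integral_mono) (simp flip: ennreal_plus ennreal_mult add: ennreal_leI)
      also have "\<dots> = ?A (F n) + ennreal (1 / K) * (\<integral>\<^sup>+x. ennreal ((geom_mean (F n) x)\<^sup>2) \<partial>lborel)"
        by (simp add: nn_integral_add nn_integral_cmult)
      also have "\<dots> \<le> ?A (F n) + ennreal (1 / K) * ennreal ((1 + D)\<^sup>2)"
        by (intro add_left_mono mult_left_mono geom_mean_L2 F) auto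
      finally show ?thesis using K by (simp flip: ennreal_mult)
    qed
    then have Mn: "M \<le> ?A (F n) + ennreal ((1 + D)\<^sup>2 / K) + ennreal (1 / real (Suc n))" for n
      using M[of n] by (meson add_right_mono order_trans)
    have "(\<lambda>n. ?A (F n)) \<longlonglongrightarrow> ?A f"
    proof (rule nn_integral_dominated_convergence)
      show "AE x in lborel. ennreal (min (G x * geom_mean (F n) x) (K * (G x)\<^sup>2)) \<le> ennreal K * ennreal ((G x)\<^sup>2)" for n
        using K by (simp add: ennreal_leI flip: ennreal_mult)
      show "(\<integral>\<^sup>+x. ennreal K * ennreal ((G x)\<^sup>2) \<partial>lborel) < \<infinity>"
        by (simp add: nn_integral_cmult G_int ennreal_mult_less_top)
      show "AE x in lborel. (\<lambda>n. ennreal (min (G x * geom_mean (F n) x) (K * (G x)\<^sup>2)))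
          \<longlonglongrightarrow> ennreal (min (G x * geom_mean f x) (K * (G x)\<^sup>2))"
        using geom_mean_tendsto_AE[OF admissible_nonneg[OF F] lim]
        by eventually_elim (intro tendsto_intros)
    qed measurable
    then have "(\<lambda>n. ?A (F n) + ennreal ((1 + D)\<^sup>2 / K) + ennreal (1 / real (Suc n)))
        \<longlonglongrightarrow> ?A f + ennreal ((1 + D)\<^sup>2 / K) + ennreal 0"
      by (intro tendsto_intros LIMSEQ_Suc[OF lim_inverse_n'])
    then have "M \<le> ?A f + ennreal ((1 + D)\<^sup>2 / K) + ennreal 0"
      by (rule LIMSEQ_le_const) (use Mn in auto)
    also have "\<dots> \<le> pairing G f + ennreal ((1 + D)\<^sup>2 / K) + ennreal 0"
      unfolding pairing_def by (intro add_right_mono nn_integral_mono ennreal_leI) simp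
    finally show ?thesis by simp
  qed
  have "(\<lambda>n. pairing G f + ennreal ((1 + D)\<^sup>2 * (1 / real (Suc n)))) \<longlonglongrightarrow> pairing G f + ennreal ((1 + D)\<^sup>2 * 0)"
    by (intro tendsto_intros LIMSEQ_Suc[OF lim_inverse_n'])
  then have "M \<le> pairing G f + ennreal ((1 + D)\<^sup>2 * 0)"
    by (rule LIMSEQ_le_const) (use bd in auto)
  then show ?thesis by simp
qed

lemma pairing_concave:
  assumes f: "f \<in> admissible p" and g: "g \<in> admissible p"
  shows "pairing G f + pairing G g \<le> 2 * pairing G (\<lambda>j s. (f j s + g j s) / 2)"
proof -
  note [measurable] = admissible_measurable[OF f] admissible_measurable[OF g]
  have "pairing G f + pairing G g = (\<integral>\<^sup>+x. ennreal (G x * geom_mean f x) + ennreal (G x * geom_mean g x) \<partial>lborel)"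
    unfolding pairing_def by (simp add: nn_integral_add)
  also have "\<dots> \<le> (\<integral>\<^sup>+x. ennreal 2 * ennreal (G x * geom_mean (\<lambda>j s. (f j s + g j s) / 2) x) \<partial>lborel)"
  proof (intro nn_integral_mono)
    fix x
    have "G x * ((geom_mean f x + geom_mean g x) / 2) \<le> G x * geom_mean (\<lambda>j s. (f j s + g j s) / 2) x"
      by (intro mult_left_mono geom_mean_concave admissible_nonneg[OF f] admissible_nonneg[OF g] G0)
    then have "G x * geom_mean f x + G x * geom_mean g x \<le> 2 * (G x * geom_mean (\<lambda>j s. (f j s + g j s) / 2) x)"
      by (simp add: field_simps)
    then show "ennreal (G x * geom_mean f x) + ennreal (G x * geom_mean g x)
        \<le> ennreal 2 * ennreal (G x * geom_mean (\<lambda>j s. (f j s + g j s) / 2) x)"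
      using G0[of x] by (simp del: ennreal_numeral flip: ennreal_plus ennreal_mult add: ennreal_leI)
  qed
  also have "\<dots> = 2 * pairing G (\<lambda>j s. (f j s + g j s) / 2)"
    unfolding pairing_def by (simp add: nn_integral_cmult)
  finally show ?thesis .
qed

lemma p_admissible: "(\<lambda>_. p) \<in> admissible p"
  by (auto simp: admissible_def)

text \<open>Fatou's lemma gives the mass constraint for the limit, and also excludes that the functions tend to infinity on a set of positive measure.\<close>
lemma admissible_limit:
  assumes F: "\<And>n. F n \<in> admissible p"
    and conv: "\<And>j. AE s in lborel. convergent (\<lambda>n. exp (- F n j s / 2))"
  obtains f where "f \<in> admissible p" "\<And>j. AE s in lborel. (\<lambda>n. F n j s) \<longlonglongrightarrow> f j s"
proof -
  note [measurable] = admissible_measurable[OF F]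
  define L where "L j s = liminf (\<lambda>n. ennreal (F n j s))" for j s
  have L_meas[measurable]: "L j \<in> borel_measurable borel" for j unfolding L_def by measurable
  \<comment> \<open>The maximum enforces the floor also on the null set where the sequence does not converge.\<close>
  define f where "f j s = max (p s) (enn2real (L j s))" for j s
  have f_meas[measurable]: "f j \<in> borel_measurable borel" for j unfolding f_def by measurable
  have lim: "AE s in lborel. (\<lambda>n. F n j s) \<longlonglongrightarrow> f j s" for j
  proof -
    have "(\<integral>\<^sup>+s. L j s \<partial>lborel) \<le> liminf (\<lambda>n. \<integral>\<^sup>+s. ennreal (F n j s) \<partial>lborel)"
      unfolding L_def by (rule nn_integral_liminf) measurable
    also have "\<dots> \<le> ennreal (1 + D)"
      by (intro Liminf_le always_eventually allI admissible_integral F) simp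
    finally have "(\<integral>\<^sup>+s. L j s \<partial>lborel) < \<infinity>" by (rule le_less_trans) simp
    then have "AE s in lborel. L j s \<noteq> \<infinity>"
      by (intro nn_integral_PInf_AE) auto
    with conv[of j] show ?thesis
    proof eventually_elim
      fix s assume "convergent (\<lambda>n. exp (- F n j s / 2))" and fin: "L j s \<noteq> \<infinity>"
      then obtain l where l: "(\<lambda>n. exp (- F n j s / 2)) \<longlonglongrightarrow> l" by (auto simp: convergent_def)
      have "0 \<le> l" by (rule LIMSEQ_le_const[OF l]) auto
      have "l \<noteq> 0"
      proof
        assume "l = 0"
        then have "filterlim (\<lambda>n. exp (- F n j s / 2)) (at_right 0) sequentially"
          using l by (auto simp: filterlim_at)
        then have "filterlim (\<lambda>n. ln (exp (- F n j s / 2))) at_bot sequentially"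
          by (rule filterlim_compose[OF ln_at_0])
        then have "filterlim (\<lambda>n. - (- F n j s / 2)) at_top sequentially"
          by (simp add: filterlim_uminus_at_top)
        then have "filterlim (\<lambda>n. 2 * (- (- F n j s / 2))) at_top sequentially"
          by (rule filterlim_tendsto_pos_mult_at_top[OF tendsto_const, rotated]) simp
        then have top: "filterlim (\<lambda>n. F n j s) at_top sequentially" by simp
        have "(\<lambda>n. ennreal (F n j s)) \<longlonglongrightarrow> \<infinity>"
          using top by (simp add: ennreal_tendsto_top_eq_at_top)
        then have "L j s = \<infinity>" unfolding L_def by (intro lim_imp_Liminf) auto
        then show False using fin by simp
      qed
      with \<open>0 \<le> l\<close> have "0 < l" by simp
      have "(\<lambda>n. - 2 * ln (exp (- F n j s / 2))) \<longlonglongrightarrow> - 2 * ln l"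
        using \<open>0 < l\<close> by (intro tendsto_intros l) auto
      then have F_lim: "(\<lambda>n. F n j s) \<longlonglongrightarrow> - 2 * ln l" by simp
      have "p s \<le> F n j s" for n using F[of n] by (auto simp: admissible_def)
      then have pl: "p s \<le> - 2 * ln l" by (intro LIMSEQ_le_const[OF F_lim]) auto
      have "(\<lambda>n. ennreal (F n j s)) \<longlonglongrightarrow> ennreal (- 2 * ln l)"
        by (rule tendsto_ennrealI[OF F_lim])
      then have "L j s = ennreal (- 2 * ln l)" unfolding L_def by (intro lim_imp_Liminf) auto
      then have "f j s = - 2 * ln l" using pl p0[of s] by (simp add: f_def)
      then show "(\<lambda>n. F n j s) \<longlonglongrightarrow> f j s" using F_lim by simp
    qed
  qed
  have "f \<in> admissible p"
    unfolding admissible_def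
  proof (intro CollectI allI conjI f_meas)
    fix j
    show "p s \<le> f j s" for s by (simp add: f_def)
    have "(\<integral>\<^sup>+s. ennreal (f j s - p s) \<partial>lborel) = (\<integral>\<^sup>+s. liminf (\<lambda>n. ennreal (F n j s - p s)) \<partial>lborel)"
    proof (rule nn_integral_cong_AE, use lim[of j] in eventually_elim)
      fix s assume "(\<lambda>n. F n j s) \<longlonglongrightarrow> f j s"
      then have "(\<lambda>n. ennreal (F n j s - p s)) \<longlonglongrightarrow> ennreal (f j s - p s)" by (intro tendsto_intros)
      then show "ennreal (f j s - p s) = liminf (\<lambda>n. ennreal (F n j s - p s))"
        by (intro lim_imp_Liminf[symmetric]) auto
    qed
    also have "\<dots> \<le> liminf (\<lambda>n. \<integral>\<^sup>+s. ennreal (F n j s - p s) \<partial>lborel)"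
      by (rule nn_integral_liminf) measurable
    also have "\<dots> \<le> 1"
      using F by (intro Liminf_le always_eventually) (auto simp: admissible_def)
    finally show "(\<integral>\<^sup>+s. ennreal (f j s - p s) \<partial>lborel) \<le> 1" .
  qed
  then show ?thesis using that lim by blast
qed

text \<open>By concavity of the pairing the sets of near-maximisers are closed under midpoints, so \<open>convex_selection\<close> applies to them.  The Gaussian measure is a probability measure with the null sets of Lebesgue measure.\<close>
lemma maximiser_exists:
  obtains f where "f \<in> admissible p" "\<And>g. g \<in> admissible p \<Longrightarrow> pairing G g \<le> pairing G f"
proof -
  define M where "M = (SUP f\<in>admissible p. pairing G f)"
  have "M \<le> ennreal (N * (1 + D))" unfolding M_def by (intro SUP_least pairing_le)
  then have M_fin: "M \<noteq> \<infinity>" by (auto simp: top_unique)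
  define S where "S n = {f \<in> admissible p. M \<le> pairing G f + ennreal (1 / real (Suc n))}" for n
  interpret std: prob_space "density lborel std_normal_density" by (rule prob_space_normal_density) simp
  obtain F where F: "\<And>n. F n \<in> S n"
    and conv: "\<And>j. AE s in density lborel std_normal_density. convergent (\<lambda>n. exp (- F n j s / 2))"
  proof (rule convex_selection[of "density lborel std_normal_density" S])
    show "prob_space (density lborel std_normal_density)" by unfold_locales
    show "f j \<in> borel_measurable (density lborel std_normal_density)" if "f \<in> S n" for n f j
      using that admissible_measurable[of f j] by (simp add: S_def)
    show "0 \<le> f j s" if "f \<in> S n" for n f j s
      using that admissible_nonneg by (simp add: S_def)
    show "S n \<subseteq> S m" if "m \<le> n" for m n
    proof -
      have "ennreal (1 / real (Suc n)) \<le> ennreal (1 / real (Suc m))"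
        using that by (intro ennreal_leI divide_left_mono) auto
      then show ?thesis unfolding S_def by (auto intro: order_trans add_left_mono)
    qed
    show "S n \<noteq> {}" for n
    proof -
      have "\<exists>f\<in>admissible p. M < pairing G f + ennreal (1 / real (Suc n))"
        by (rule SUP_approx_ennreal[OF _ _ M_def]) (use p_admissible M_fin in auto)
      then show ?thesis by (auto simp: S_def intro: less_imp_le)
    qed
    fix n f g assume fg: "f \<in> S n" "g \<in> S n"
    let ?h = "\<lambda>j s. (f j s + g j s) / 2"
    have "M + M \<le> (pairing G f + ennreal (1 / real (Suc n))) + (pairing G g + ennreal (1 / real (Suc n)))"
      using fg by (intro add_mono) (auto simp: S_def)
    also have "\<dots> = (pairing G f + pairing G g) + 2 * ennreal (1 / real (Suc n))"
      by (simp add: mult_2 add_ac)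
    also have "\<dots> \<le> 2 * pairing G ?h + 2 * ennreal (1 / real (Suc n))"
      using fg by (intro add_right_mono pairing_concave) (auto simp: S_def)
    finally have "2 * M \<le> 2 * (pairing G ?h + ennreal (1 / real (Suc n)))"
      by (simp add: mult_2 distrib_left)
    then have "M \<le> pairing G ?h + ennreal (1 / real (Suc n))"
      by (subst (asm) ennreal_mult_le_mult_iff) auto
    then show "?h \<in> S n" using fg admissible_midpoint by (simp add: S_def)
  qed (rule that)
  have FA: "F n \<in> admissible p" for n using F by (simp add: S_def)
  have "AE s in lborel. convergent (\<lambda>n. exp (- F n j s / 2))" for j
    using conv[of j] by (subst (asm) AE_density) (auto simp: normal_density_pos)
  from admissible_limit[OF FA this] obtain f where f: "f \<in> admissible p"
    and lim: "\<And>j. AE s in lborel. (\<lambda>n. F n j s) \<longlonglongrightarrow> f j s" by blast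
  have "M \<le> pairing G f"
    by (rule pairing_limit[OF FA f lim]) (use F in \<open>simp add: S_def\<close>)
  moreover have "pairing G g \<le> M" if "g \<in> admissible p" for g
    unfolding M_def using that by (rule SUP_upper)
  ultimately show ?thesis using that f order_trans by blast
qed

section \<open>The first variation at a maximiser\<close>

text \<open>The competitor has $u_j = f_j (1 + \epsilon 1_A) - p$, scaled down by at least $1 + \epsilon \int_A f_j$, above the floor
  in place of $f_j - p$.  Setting $1 + \epsilon = (1 + \eta)^3$ and scaling by $q^3$ with $q = 1 + \frac{\epsilon}{3} \int_A f_j$
  makes the cube roots explicit: the pairing of the competitor is at least $(M + \eta I) / q$, where $I$ is the left-hand side.
  Maximality and $\eta \to 0$ yield $I \le M \int_A f_j$.\<close>
lemma first_variation:
  assumes f: "f \<in> admissible p" and max: "\<And>g. g \<in> admissible p \<Longrightarrow> pairing G g \<le> pairing G f"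
    and M: "pairing G f = ennreal M" "0 \<le> M" and A[measurable]: "A \<in> sets borel"
  shows "(\<integral>\<^sup>+x. ennreal (G x * geom_mean f x) * indicator A (e j \<bullet> x) \<partial>lborel)
    \<le> (\<integral>\<^sup>+s. ennreal (M * f j s) * indicator A s \<partial>lborel)"
proof -
  note [measurable] = admissible_measurable[OF f]
  note f0 = admissible_nonneg[OF f]
  define I where "I = (\<integral>\<^sup>+x. ennreal (G x * geom_mean f x) * indicator A (e j \<bullet> x) \<partial>lborel)"
  have "I \<le> pairing G f" unfolding I_def pairing_def
    by (intro nn_integral_mono) (auto split: split_indicator)
  then obtain i where i: "I = ennreal i" "0 \<le> i"
    unfolding M by (cases I) (auto simp: top_unique)
  define a' where "a' = (\<integral>\<^sup>+s. ennreal (f j s) * indicator A s \<partial>lborel)"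
  have "a' \<le> (\<integral>\<^sup>+s. ennreal (f j s) \<partial>lborel)" unfolding a'_def
    by (intro nn_integral_mono) (auto split: split_indicator)
  also note admissible_integral[OF f]
  finally obtain a where a: "a' = ennreal a" "0 \<le> a"
    by (cases a') (auto simp: top_unique)
  have key: "i \<le> M * a * (1 + \<eta> + \<eta>\<^sup>2 / 3)" if \<eta>: "0 < \<eta>" for \<eta>
  proof -
    define \<epsilon> where "\<epsilon> = (1 + \<eta>) ^ 3 - 1"
    have \<epsilon>: "\<epsilon> = 3 * \<eta> * (1 + \<eta> + \<eta>\<^sup>2 / 3)" by (simp add: \<epsilon>_def power2_eq_square power3_eq_cube algebra_simps)
    have \<epsilon>0: "0 \<le> \<epsilon>" using \<eta> unfolding \<epsilon> by simp
    define q where "q = 1 + \<epsilon> * a / 3"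
    have q1: "1 \<le> q" using \<epsilon>0 a by (simp add: q_def)
    \<comment> \<open>Bernoulli's inequality: the scaling by $q^3$ suffices for the mass constraint.\<close>
    have q3: "1 + \<epsilon> * a \<le> q ^ 3"
    proof -
      have "q ^ 3 = 1 + \<epsilon> * a + (\<epsilon> * a)\<^sup>2 / 3 + (\<epsilon> * a) ^ 3 / 27"
        unfolding q_def by (simp add: power2_eq_square power3_eq_cube field_simps)
      then show ?thesis using \<epsilon>0 a by simp
    qed
    have q31: "1 \<le> q ^ 3" using q1 by simp
    define u where "u s = (f j s * (1 + \<epsilon> * indicator A s) - p s) / q ^ 3" for s
    define g where "g = f(j := (\<lambda>s. u s + p s))"
    have u_eq: "f j s * (1 + \<epsilon> * indicator A s) - p s = (f j s - p s) + \<epsilon> * (f j s * indicator A s)" for s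
      by (simp add: algebra_simps)
    have fp: "p s \<le> f j s" for s using f by (auto simp: admissible_def)
    have nn: "0 \<le> f j s * (1 + \<epsilon> * indicator A s) - p s" for s
      unfolding u_eq using fp[of s] \<epsilon>0 f0 by simp
    have "g \<in> admissible p"
      unfolding admissible_def
    proof (intro CollectI allI)
      fix k
      show "g k \<in> borel_measurable borel \<and> (\<forall>s. p s \<le> g k s) \<and> (\<integral>\<^sup>+s. ennreal (g k s - p s) \<partial>lborel) \<le> 1"
      proof (cases "k = j")
        case True
        have "(\<integral>\<^sup>+s. ennreal (g j s - p s) \<partial>lborel)
          = (\<integral>\<^sup>+s. ennreal (1 / q ^ 3) * (ennreal (f j s - p s) + ennreal \<epsilon> * (ennreal (f j s) * indicator A s)) \<partial>lborel)"
        proof (intro nn_integral_cong)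
          fix s
          have "g j s - p s = 1 / q ^ 3 * ((f j s - p s) + \<epsilon> * (f j s * indicator A s))"
            unfolding g_def u_def u_eq by simp
          moreover have "ennreal (f j s * indicator A s) = ennreal (f j s) * indicator A s"
            by (simp split: split_indicator)
          ultimately show "ennreal (g j s - p s) = ennreal (1 / q ^ 3) * (ennreal (f j s - p s) + ennreal \<epsilon> * (ennreal (f j s) * indicator A s))"
            using fp[of s] f0[of j s] \<epsilon>0 q1
            by (simp add: ennreal_mult[symmetric] ennreal_plus[symmetric] del: ennreal_plus flip: \<open>ennreal (f j s * indicator A s) = _\<close>)
        qed
        also have "\<dots> = ennreal (1 / q ^ 3) * ((\<integral>\<^sup>+s. ennreal (f j s - p s) \<partial>lborel) + ennreal \<epsilon> * a')"
          unfolding a'_def by (simp add: nn_integral_cmult nn_integral_add)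
        also have "\<dots> \<le> ennreal (1 / q ^ 3) * (1 + ennreal \<epsilon> * a')"
          using f by (intro mult_left_mono add_right_mono) (auto simp: admissible_def)
        also have "\<dots> = ennreal (1 / q ^ 3 * (1 + \<epsilon> * a))"
          unfolding a(1) ennreal_1[symmetric] using \<epsilon>0 a q1
          by (simp add: ennreal_mult[symmetric] ennreal_plus[symmetric] del: ennreal_plus ennreal_1)
        also have "\<dots> \<le> ennreal 1"
          using q1 q3 by (intro ennreal_leI) (simp add: divide_le_eq)
        finally have "(\<integral>\<^sup>+s. ennreal (g j s - p s) \<partial>lborel) \<le> 1" by simp
        moreover have "g j \<in> borel_measurable borel" unfolding g_def u_def by simp
        moreover have "p s \<le> g j s" for s using nn[of s] q1 by (simp add: g_def u_def)
        ultimately show ?thesis using True by simp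
      next
        case False
        then show ?thesis using f by (simp add: g_def admissible_def)
      qed
    qed
    then have "pairing G g \<le> ennreal M" using max M by metis
    moreover have "ennreal ((M + \<eta> * i) / q) \<le> pairing G g"
    proof -
      have pw: "1 / q * (G x * geom_mean f x + \<eta> * (G x * geom_mean f x * indicator A (e j \<bullet> x))) \<le> G x * geom_mean g x" for x
      proof -
        let ?c = "(1 + \<eta> * indicator A (e j \<bullet> x)) / q"
        have "?c * geom_mean f x \<le> geom_mean g x"
        proof (rule geom_mean_ge[where j=j])
          show "0 \<le> ?c" using \<eta> q1 by simp
          show "0 \<le> f i (e i \<bullet> x)" for i by (rule f0)
          show "f i (e i \<bullet> x) \<le> g i (e i \<bullet> x)" if "i \<noteq> j" for i using that by (simp add: g_def)
          have c3: "?c ^ 3 = (1 + \<epsilon> * indicator A (e j \<bullet> x)) / q ^ 3"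
            by (simp add: \<epsilon>_def power_divide split: split_indicator)
          have "p (e j \<bullet> x) / q ^ 3 \<le> p (e j \<bullet> x)"
            using mult_left_mono[OF q31 p0[of "e j \<bullet> x"]] q1 by (simp add: divide_le_eq)
          then show "?c ^ 3 * f j (e j \<bullet> x) \<le> g j (e j \<bullet> x)"
            unfolding c3 by (simp add: g_def u_def diff_divide_distrib mult.commute)
        qed
        from mult_left_mono[OF this G0[of x]] show ?thesis
          by (simp add: field_simps)
      qed
      have "ennreal ((M + \<eta> * i) / q) = ennreal (1 / q) * (pairing G f + ennreal \<eta> * I)"
        unfolding i M using \<eta> i q1 M by (simp add: ennreal_mult[symmetric] ennreal_plus[symmetric] del: ennreal_plus)
      also have "\<dots> = (\<integral>\<^sup>+x. ennreal (1 / q) * (ennreal (G x * geom_mean f x)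
          + ennreal \<eta> * (ennreal (G x * geom_mean f x) * indicator A (e j \<bullet> x))) \<partial>lborel)"
        unfolding pairing_def I_def by (simp add: nn_integral_cmult nn_integral_add)
      also have "\<dots> \<le> pairing G g"
        unfolding pairing_def
      proof (intro nn_integral_mono)
        fix x
        have ind: "ennreal (G x * geom_mean f x * indicator A (e j \<bullet> x)) = ennreal (G x * geom_mean f x) * indicator A (e j \<bullet> x)"
          by (simp split: split_indicator)
        have "ennreal (1 / q) * (ennreal (G x * geom_mean f x)
          + ennreal \<eta> * (ennreal (G x * geom_mean f x) * indicator A (e j \<bullet> x)))
          = ennreal (1 / q * (G x * geom_mean f x + \<eta> * (G x * geom_mean f x * indicator A (e j \<bullet> x))))"
          unfolding ind[symmetric] using G0[of x] \<eta> q1 by (simp add: ennreal_mult[symmetric] ennreal_plus[symmetric] del: ennreal_plus)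
        also have "\<dots> \<le> ennreal (G x * geom_mean g x)" by (rule ennreal_leI[OF pw])
        finally show "ennreal (1 / q) * (ennreal (G x * geom_mean f x)
          + ennreal \<eta> * (ennreal (G x * geom_mean f x) * indicator A (e j \<bullet> x))) \<le> ennreal (G x * geom_mean g x)" .
      qed
      finally show ?thesis .
    qed
    ultimately have "ennreal ((M + \<eta> * i) / q) \<le> ennreal M" by (rule order_trans[rotated])
    then have "(M + \<eta> * i) / q \<le> M" using M by (simp add: ennreal_le_iff)
    then have "M + \<eta> * i \<le> M * q" using q1 by (simp add: divide_le_eq)
    then have "\<eta> * i \<le> \<eta> * (M * a * (1 + \<eta> + \<eta>\<^sup>2 / 3))" unfolding q_def \<epsilon> by (simp add: algebra_simps)
    then show ?thesis using \<eta> by simp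
  qed
  have "((\<lambda>\<eta>. M * a * (1 + \<eta> + \<eta>\<^sup>2 / 3)) \<longlongrightarrow> M * a * (1 + 0 + 0\<^sup>2 / 3)) (at_right 0)"
    by (intro tendsto_intros) simp_all
  then have "i \<le> M * a * (1 + 0 + 0\<^sup>2 / 3)"
    by (rule tendsto_lowerbound) (use eventually_mono[OF eventually_at_right_less key] in auto)
  then have "I \<le> ennreal M * a'" using M a i by (simp add: ennreal_leI flip: ennreal_mult)
  also have "\<dots> = (\<integral>\<^sup>+s. ennreal (M * f j s) * indicator A s \<partial>lborel)"
    unfolding a'_def using M f0 by (subst nn_integral_cmult[symmetric]) (auto simp: ennreal_mult mult_ac intro!: nn_integral_cong)
  finally show ?thesis unfolding I_def .
qed

text \<open>Localisation of \<open>first_variation\<close>: it is applied to the set of those $s$ for which the line integral is too large.\<close>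
lemma euler_lagrange:
  assumes f: "f \<in> admissible p" and max: "\<And>g. g \<in> admissible p \<Longrightarrow> pairing G g \<le> pairing G f"
    and M: "pairing G f = ennreal M" "0 \<le> M" and v: "norm v = 1" "e j \<bullet> v = 0"
  shows "AE s in lborel. (\<integral>\<^sup>+t. ennreal (G (s *\<^sub>R e j + t *\<^sub>R v) * geom_mean f (s *\<^sub>R e j + t *\<^sub>R v)) \<partial>lborel)
     \<le> ennreal (M * f j s)"
proof -
  note [measurable] = admissible_measurable[OF f]
  define \<Phi> where "\<Phi> s = (\<integral>\<^sup>+t. ennreal (G (s *\<^sub>R e j + t *\<^sub>R v) * geom_mean f (s *\<^sub>R e j + t *\<^sub>R v)) \<partial>lborel)" for s
  have \<Phi>_meas[measurable]: "\<Phi> \<in> borel_measurable borel" unfolding \<Phi>_def by measurable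
  define A where "A = {s. ennreal (M * f j s) < \<Phi> s}"
  have A[measurable]: "A \<in> sets borel" unfolding A_def by measurable
  have ee: "e j \<bullet> e j = 1" using norm_e by (simp add: norm_eq_1)
  let ?\<psi> = "\<lambda>s. ennreal (M * f j s) * indicator A s"
  have "(\<integral>\<^sup>+s. \<Phi> s * indicator A s \<partial>lborel) = (\<integral>\<^sup>+x. ennreal (G x * geom_mean f x) * indicator A (e j \<bullet> x) \<partial>lborel)"
    by (subst nn_integral_orthonormal_frame[OF norm_e v])
       (auto simp: inner_add_right ee v \<Phi>_def nn_integral_multc)
  also have "\<dots> \<le> (\<integral>\<^sup>+s. ?\<psi> s \<partial>lborel)" by (rule first_variation[OF f max M A])
  finally have le: "(\<integral>\<^sup>+s. \<Phi> s * indicator A s \<partial>lborel) \<le> (\<integral>\<^sup>+s. ?\<psi> s \<partial>lborel)" .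
  \<comment> \<open>Finiteness is needed to subtract integrals.\<close>
  have "(\<integral>\<^sup>+s. ?\<psi> s \<partial>lborel) \<le> (\<integral>\<^sup>+s. ennreal M * ennreal (f j s) \<partial>lborel)"
    using M admissible_nonneg[OF f] by (intro nn_integral_mono) (auto split: split_indicator simp: ennreal_mult)
  also have "\<dots> \<le> ennreal M * ennreal (1 + D)"
    by (subst nn_integral_cmult) (auto intro!: mult_left_mono admissible_integral f)
  also have "\<dots> < \<infinity>" by (simp add: ennreal_mult_less_top)
  finally have fin: "(\<integral>\<^sup>+s. ?\<psi> s \<partial>lborel) \<noteq> \<infinity>" by simp
  have "(\<integral>\<^sup>+s. \<Phi> s * indicator A s - ?\<psi> s \<partial>lborel)
      = (\<integral>\<^sup>+s. \<Phi> s * indicator A s \<partial>lborel) - (\<integral>\<^sup>+s. ?\<psi> s \<partial>lborel)"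
    by (rule nn_integral_diff) (use fin in \<open>auto simp: A_def split: split_indicator\<close>)
  also have "\<dots> = 0" using le fin by (simp add: diff_eq_0_iff_ennreal less_top[symmetric] neq_top_trans)
  finally have "AE s in lborel. \<Phi> s * indicator A s - ?\<psi> s = 0"
    by (subst (asm) nn_integral_0_iff_AE) auto
  then show ?thesis
  proof eventually_elim
    fix s assume *: "\<Phi> s * indicator A s - ?\<psi> s = 0"
    have "s \<notin> A"
    proof
      assume s: "s \<in> A"
      then have "\<Phi> s - ennreal (M * f j s) = 0" using * by simp
      then have "\<Phi> s \<le> ennreal (M * f j s)" by (simp add: diff_eq_0_iff_ennreal)
      then show False using s by (auto simp: A_def)
    qed
    then show "(\<integral>\<^sup>+t. ennreal (G (s *\<^sub>R e j + t *\<^sub>R v) * geom_mean f (s *\<^sub>R e j + t *\<^sub>R v)) \<partial>lborel)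
     \<le> ennreal (M * f j s)" by (simp add: A_def \<Phi>_def not_less)
  qed
qed

end

section \<open>Restriction to lines\<close>

text \<open>The lines parallel to $v$ can be parametrised by two unit normals, which differ by a reflection.\<close>
lemma unit_normal_eq_or_uminus:
  fixes v w w' :: "real^2"
  assumes "norm v = 1" "norm w = 1" "norm w' = 1" "w \<bullet> v = 0" "w' \<bullet> v = 0"
  shows "w' = w \<or> w' = - w"
proof -
  have co: "v$1 * v$1 + v$2 * v$2 = 1" "w$1 * w$1 + w$2 * w$2 = 1" "w'$1 * w'$1 + w'$2 * w'$2 = 1"
    "w$1 * v$1 + w$2 * v$2 = 0" "w'$1 * v$1 + w'$2 * v$2 = 0"
    using assms by (simp_all add: norm_eq_1 inner_vec_def sum_2)
  define k where "k = w$1 * w'$2 - w$2 * w'$1"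
  have k: "k = 0" using co unfolding k_def by algebra
  define c where "c = w \<bullet> w'"
  have c: "c\<^sup>2 = 1"
    using co k unfolding c_def k_def by (simp add: inner_vec_def sum_2 power2_eq_square) algebra
  have "(w' - c *\<^sub>R w) \<bullet> (w' - c *\<^sub>R w) = 0"
    using assms c by (simp add: inner_diff_left inner_diff_right norm_eq_1 inner_commute c_def power2_eq_square)
  then have "w' = c *\<^sub>R w" by simp
  moreover have "c = 1 \<or> c = -1" using c by (simp add: power2_eq_1_iff)
  ultimately show ?thesis by auto
qed

lemma AE_lborel_reflect:
  fixes h :: "real \<Rightarrow> ennreal"
  assumes [measurable]: "h \<in> borel_measurable borel" and "AE s in lborel. h s \<le> c"
  shows "AE s in lborel. h (- s) \<le> c"
proof -
  have "AE s in distr lborel borel uminus. h s \<le> c" unfolding lborel_distr_uminus by (rule assms(2))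
  then show ?thesis by (subst (asm) AE_distr_iff) auto
qed

text \<open>Integrating the bound over a bounded range of parameters $s$ covers every compact set, so a bound on line integrals entails local integrability.\<close>
lemma
  fixes v w :: "real^2" and g :: "real^2 \<Rightarrow> real"
  assumes v: "norm v = 1" and w: "norm w = 1" "w \<bullet> v = 0"
    and g[measurable]: "g \<in> borel_measurable borel" and g0: "\<And>x. 0 \<le> g x" and C: "0 \<le> C"
    and le: "AE s in lborel. (\<integral>\<^sup>+t. ennreal (g (s *\<^sub>R w + t *\<^sub>R v)) \<partial>lborel) \<le> ennreal C"
  shows line_integralI: "ae_line_integral_le v g C"
    and locally_integrableI: "locally_integrable g"
proof -
  define h where "h s = (\<integral>\<^sup>+t. ennreal (g (s *\<^sub>R w + t *\<^sub>R v)) \<partial>lborel)" for s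
  have h[measurable]: "h \<in> borel_measurable borel" unfolding h_def by measurable
  have leh: "AE s in lborel. h s \<le> ennreal C" using le unfolding h_def .
  show "ae_line_integral_le v g C"
    unfolding ae_line_integral_le_def
  proof (intro allI impI)
    fix w' :: "real^2" assume w': "norm w' = 1 \<and> orthogonal w' v"
    then have "w' = w \<or> w' = - w"
      using unit_normal_eq_or_uminus[OF v w(1) _ w(2), of w'] by (simp add: orthogonal_def)
    then have "AE s in lborel. (\<integral>\<^sup>+t. ennreal (g (s *\<^sub>R w' + t *\<^sub>R v)) \<partial>lborel) \<le> ennreal C"
    proof
      assume "w' = w" then show ?thesis using le by simp
    next
      assume "w' = - w" then show ?thesis using AE_lborel_reflect[OF h leh] by (simp add: h_def)
    qed
    then show "AE s in lebesgue. integrable lebesgue (\<lambda>t. g (s *\<^sub>R w' + t *\<^sub>R v)) \<and>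
          (LINT t|lebesgue. g (s *\<^sub>R w' + t *\<^sub>R v)) \<le> C"
      unfolding AE_completion_iff
    proof eventually_elim
      fix s assume *: "(\<integral>\<^sup>+t. ennreal (g (s *\<^sub>R w' + t *\<^sub>R v)) \<partial>lborel) \<le> ennreal C"
      have m: "(\<lambda>t. g (s *\<^sub>R w' + t *\<^sub>R v)) \<in> borel_measurable lborel" by measurable
      have i: "integrable lborel (\<lambda>t. g (s *\<^sub>R w' + t *\<^sub>R v))"
        by (rule integrableI_nonneg) (use g0 le_less_trans[OF *] in auto)
      have "(LINT t|lborel. g (s *\<^sub>R w' + t *\<^sub>R v)) \<le> C"
        using * C by (subst (asm) nn_integral_eq_integral[OF i]) (auto simp: g0)
      then show "integrable lebesgue (\<lambda>t. g (s *\<^sub>R w' + t *\<^sub>R v)) \<and>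
          (LINT t|lebesgue. g (s *\<^sub>R w' + t *\<^sub>R v)) \<le> C"
        using i m by (simp add: integrable_completion integral_completion)
    qed
  qed
  show "locally_integrable g"
    unfolding locally_integrable_def
  proof (intro allI impI)
    fix K :: "(real^2) set" assume K: "compact K"
    then have [measurable]: "K \<in> sets borel" by (intro borel_compact)
    obtain R where R: "\<And>x. x \<in> K \<Longrightarrow> norm x \<le> R"
      using compact_imp_bounded[OF K] unfolding bounded_iff by auto
    have "(\<integral>\<^sup>+x. ennreal (indicator K x *\<^sub>R g x) \<partial>lborel)
        \<le> (\<integral>\<^sup>+x. indicator {-R..R} (w \<bullet> x) * ennreal (g x) \<partial>lborel)"
    proof (intro nn_integral_mono)
      fix x
      have "w \<bullet> x \<in> {-R..R}" if "x \<in> K"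
        using Cauchy_Schwarz_ineq2[of w x] R[OF that] w by (auto simp: abs_le_iff)
      then show "ennreal (indicator K x *\<^sub>R g x) \<le> indicator {-R..R} (w \<bullet> x) * ennreal (g x)"
        by (auto split: split_indicator)
    qed
    also have "\<dots> = (\<integral>\<^sup>+s. indicator {-R..R} s * h s \<partial>lborel)"
      using w by (subst nn_integral_orthonormal_frame[OF w(1) v w(2)])
        (auto simp: inner_add_right norm_eq_1 h_def nn_integral_cmult)
    also have "\<dots> \<le> (\<integral>\<^sup>+s. ennreal C * indicator {-R..R} s \<partial>lborel)"
      by (rule nn_integral_mono_AE, use leh in eventually_elim) (auto split: split_indicator)
    also have "\<dots> < \<infinity>"
      using emeasure_lborel_cbox_finite[of "-R" R]
      by (subst nn_integral_cmult_indicator) (auto simp: ennreal_mult_less_top)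
    finally have "integrable lborel (\<lambda>x. indicator K x *\<^sub>R g x)"
      by (intro integrableI_nonneg) (auto simp: g0)
    then show "set_integrable lebesgue K g"
      unfolding set_integrable_def by (subst integrable_completion) auto
  qed
qed

section \<open>The factorisation\<close>

context tripod begin

text \<open>Equality in the Cauchy--Schwarz inequality: $\int (G - N H)^2 = N^2 - 2 N^2 + N^2 \int H^2 \le 0$.\<close>
lemma pairing_saturated_imp_proportional:
  assumes G[measurable]: "G \<in> borel_measurable borel" and G0: "\<And>x. 0 \<le> G x"
    and G_int: "(\<integral>\<^sup>+x. ennreal ((G x)\<^sup>2) \<partial>lborel) = ennreal (N\<^sup>2)" and N: "0 \<le> N"
    and f[measurable]: "\<And>j. f j \<in> borel_measurable borel"
    and f_int: "(\<integral>\<^sup>+x. ennreal ((geom_mean f x)\<^sup>2) \<partial>lborel) \<le> 1"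
    and eq: "pairing G f = ennreal N"
  shows "AE x in lborel. G x = N * geom_mean f x"
proof -
  let ?H = "geom_mean f"
  have Gi: "integrable lborel (\<lambda>x. (G x)\<^sup>2)"
    by (rule integrableI_nonneg) (auto simp: G_int)
  have Hi: "integrable lborel (\<lambda>x. (?H x)\<^sup>2)"
    by (rule integrableI_nonneg) (use le_less_trans[OF f_int] in auto)
  have GHi: "integrable lborel (\<lambda>x. G x * ?H x)"
    by (rule integrableI_nonneg) (use eq in \<open>auto simp: G0 pairing_def\<close>)
  have G2: "(LINT x|lborel. (G x)\<^sup>2) = N\<^sup>2"
    using nn_integral_eq_integral[OF Gi] G_int by simp
  have H2: "(LINT x|lborel. (?H x)\<^sup>2) \<le> 1"
    using nn_integral_eq_integral[OF Hi] f_int by simp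
  have GH: "(LINT x|lborel. G x * ?H x) = N"
    using nn_integral_eq_integral[OF GHi] eq N G0 by (simp add: pairing_def)
  have expand: "(G x - N * ?H x)\<^sup>2 = (G x)\<^sup>2 - 2 * N * (G x * ?H x) + N\<^sup>2 * (?H x)\<^sup>2" for x
    by (simp add: power2_eq_square algebra_simps)
  have i: "integrable lborel (\<lambda>x. (G x - N * ?H x)\<^sup>2)"
    unfolding expand using Gi Hi GHi by (intro Bochner_Integration.integrable_add Bochner_Integration.integrable_diff integrable_mult_right)
  have "(LINT x|lborel. (G x - N * ?H x)\<^sup>2) = N\<^sup>2 - 2 * N * N + N\<^sup>2 * (LINT x|lborel. (?H x)\<^sup>2)"
    unfolding expand using Gi Hi GHi by (simp add: G2 GH)
  also have "\<dots> \<le> N\<^sup>2 - 2 * N * N + N\<^sup>2 * 1"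
    by (intro add_left_mono mult_left_mono H2) simp
  also have "\<dots> = 0" by (simp add: power2_eq_square)
  finally have "(LINT x|lborel. (G x - N * ?H x)\<^sup>2) = 0" by (simp add: antisym)
  then have "AE x in lborel. (G x - N * ?H x)\<^sup>2 = 0"
    by (subst (asm) integral_nonneg_eq_0_iff_AE[OF i]) auto
  then show ?thesis by eventually_elim simp
qed

text \<open>The two cases are $M = N$ and $M < N$ for the maximum $M$ of the problem without floor.  In the second case the problem is solved again with a Gaussian floor.\<close>
lemma extremal_weights:
  assumes G[measurable]: "G \<in> borel_measurable borel" and G0: "\<And>x. 0 \<le> G x"
    and G_int: "(\<integral>\<^sup>+x. ennreal ((G x)\<^sup>2) \<partial>lborel) = ennreal (N\<^sup>2)" and N: "0 \<le> N"
  obtains f where "\<And>j. f j \<in> borel_measurable borel" "\<And>j s. 0 \<le> f j s"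
    "AE x in lborel. 0 < G x \<longrightarrow> (\<forall>j. 0 < f j (e j \<bullet> x))"
    "\<And>j v. norm v = 1 \<Longrightarrow> e j \<bullet> v = 0 \<Longrightarrow> AE s in lborel.
      (\<integral>\<^sup>+t. ennreal (G (s *\<^sub>R e j + t *\<^sub>R v) * geom_mean f (s *\<^sub>R e j + t *\<^sub>R v)) \<partial>lborel) \<le> ennreal (N * f j s)"
proof -
  interpret P: factorisation_problem e G N "\<lambda>_. 0" 0
    by unfold_locales (use G0 G_int N in auto)
  obtain f where f: "f \<in> admissible (\<lambda>_. 0)"
    and fmax: "\<And>g. g \<in> admissible (\<lambda>_. 0) \<Longrightarrow> pairing G g \<le> pairing G f"
    using P.maximiser_exists by blast
  have "pairing G f \<le> ennreal N" using P.pairing_le[OF f] by simp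
  then obtain M where M: "pairing G f = ennreal M" "0 \<le> M" "M \<le> N"
    using N by (cases "pairing G f") (auto simp: top_unique)
  show ?thesis
  proof (cases "M = N")
    case True
    note fm[measurable] = P.admissible_measurable[OF f]
    have "AE x in lborel. G x = N * geom_mean f x"
      by (rule pairing_saturated_imp_proportional[OF G G0 G_int N fm]) (use P.geom_mean_L2[OF f] M True in simp_all)
    then have "AE x in lborel. 0 < G x \<longrightarrow> (\<forall>j. 0 < f j (e j \<bullet> x))"
    proof eventually_elim
      fix x assume *: "G x = N * geom_mean f x"
      show "0 < G x \<longrightarrow> (\<forall>j. 0 < f j (e j \<bullet> x))"
      proof
        assume "0 < G x"
        then have "geom_mean f x \<noteq> 0" using * by auto
        then have "\<forall>j. f j (e j \<bullet> x) \<noteq> 0" by (simp add: geom_mean_def)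
        then show "\<forall>j. 0 < f j (e j \<bullet> x)"
          using P.admissible_nonneg[OF f] by (auto simp: less_le)
      qed
    qed
    moreover have "AE s in lborel. (\<integral>\<^sup>+t. ennreal (G (s *\<^sub>R e j + t *\<^sub>R v) * geom_mean f (s *\<^sub>R e j + t *\<^sub>R v)) \<partial>lborel) \<le> ennreal (N * f j s)"
      if "norm v = 1" "e j \<bullet> v = 0" for j v
      using P.euler_lagrange[OF f fmax M(1,2) that] True by simp
    ultimately show ?thesis using that fm P.admissible_nonneg[OF f] by blast
  next
    case False
    \<comment> \<open>The mass of the floor is chosen such that $(1 + D) M \le N$; the summand $1$ in the denominator covers $M = 0$.\<close>
    define D where "D = (N - M) / (M + 1)"
    have D: "0 < D" using False M by (simp add: D_def)
    have DM: "(1 + D) * M \<le> N"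
    proof -
      have "(N - M) * M \<le> (N - M) * (M + 1)" using M by (intro mult_left_mono) auto
      then show ?thesis using M by (simp add: D_def field_simps)
    qed
    let ?p = "\<lambda>s. D * std_normal_density s"
    interpret Q: factorisation_problem e G N ?p D
    proof unfold_locales
      have "(\<integral>\<^sup>+s. ennreal (?p s) \<partial>lborel) = (\<integral>\<^sup>+s. ennreal D * ennreal (std_normal_density s) \<partial>lborel)"
        using D by (simp add: ennreal_mult)
      also have "\<dots> = ennreal D" by (simp add: nn_integral_cmult nn_integral_std_normal)
      finally show "(\<integral>\<^sup>+s. ennreal (?p s) \<partial>lborel) = ennreal D" .
    qed (use G0 G_int N D in auto)
    obtain h where h: "h \<in> admissible ?p"
      and hmax: "\<And>g. g \<in> admissible ?p \<Longrightarrow> pairing G g \<le> pairing G h"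
      using Q.maximiser_exists by blast
    note hm[measurable] = Q.admissible_measurable[OF h]
    have "pairing G h \<le> ennreal N"
    proof -
      \<comment> \<open>Scaling by $1 / (1 + D)$ leads back to the problem without floor, whose maximum is $M$.\<close>
      define k where "k j s = 1 / (1 + D) * h j s" for j s
      have "k \<in> admissible (\<lambda>_. 0)"
        unfolding admissible_def
      proof (intro CollectI allI conjI)
        fix j
        show "k j \<in> borel_measurable borel" unfolding k_def by measurable
        show "0 \<le> k j s" for s unfolding k_def using D Q.admissible_nonneg[OF h] by simp
        have "(\<integral>\<^sup>+s. ennreal (k j s - 0) \<partial>lborel) = ennreal (1 / (1 + D)) * (\<integral>\<^sup>+s. ennreal (h j s) \<partial>lborel)"
          unfolding k_def using D Q.admissible_nonneg[OF h]
          by (subst nn_integral_cmult[symmetric]) (auto simp: ennreal_mult[symmetric])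
        also have "\<dots> \<le> ennreal (1 / (1 + D)) * ennreal (1 + D)"
          by (intro mult_left_mono Q.admissible_integral h) simp
        also have "\<dots> = ennreal (1 / (1 + D) * (1 + D))"
          by (rule ennreal_mult[symmetric]) (use D in auto)
        also have "\<dots> = 1" using D by simp
        finally show "(\<integral>\<^sup>+s. ennreal (k j s - 0) \<partial>lborel) \<le> 1" .
      qed
      then have k: "pairing G k \<le> ennreal M" using fmax M by metis
      have km[measurable]: "k j \<in> borel_measurable borel" for j unfolding k_def by measurable
      have hk: "h = (\<lambda>j s. (1 + D) * k j s)" using D by (simp add: k_def fun_eq_iff)
      have "pairing G h = (\<integral>\<^sup>+x. ennreal (1 + D) * ennreal (G x * geom_mean k x) \<partial>lborel)"
        unfolding pairing_def
      proof (intro nn_integral_cong)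
        fix x
        have "geom_mean h x = (1 + D) * geom_mean k x" unfolding hk using D by (intro geom_mean_scale) simp
        then show "ennreal (G x * geom_mean h x) = ennreal (1 + D) * ennreal (G x * geom_mean k x)"
          using D G0[of x] by (simp add: ennreal_mult[symmetric] mult_ac del: ennreal_plus)
      qed
      also have "\<dots> = ennreal (1 + D) * pairing G k"
        unfolding pairing_def by (rule nn_integral_cmult) measurable
      also have "\<dots> \<le> ennreal (1 + D) * ennreal M" by (intro mult_left_mono k) simp
      also have "\<dots> \<le> ennreal N" using D M DM by (simp add: ennreal_mult[symmetric] ennreal_leI del: ennreal_plus)
      finally show ?thesis .
    qed
    then obtain M' where M': "pairing G h = ennreal M'" "0 \<le> M'" "M' \<le> N"
      using N by (cases "pairing G h") (auto simp: top_unique)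
    have hpos: "0 < h j s" for j s
    proof -
      have "0 < ?p s" using D by (simp add: normal_density_pos)
      also have "\<dots> \<le> h j s" using h by (auto simp: admissible_def)
      finally show ?thesis .
    qed
    have "AE s in lborel. (\<integral>\<^sup>+t. ennreal (G (s *\<^sub>R e j + t *\<^sub>R v) * geom_mean h (s *\<^sub>R e j + t *\<^sub>R v)) \<partial>lborel) \<le> ennreal (N * h j s)"
      if "norm v = 1" "e j \<bullet> v = 0" for j v
    proof -
      have "ennreal (M' * h j s) \<le> ennreal (N * h j s)" for s
        using M' hpos[of j s] by (intro ennreal_leI mult_right_mono) auto
      moreover have "AE s in lborel. (\<integral>\<^sup>+t. ennreal (G (s *\<^sub>R e j + t *\<^sub>R v) * geom_mean h (s *\<^sub>R e j + t *\<^sub>R v)) \<partial>lborel) \<le> ennreal (M' * h j s)"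
        by (rule Q.euler_lagrange[OF h _ M'(1,2) that]) (rule hmax)
      ultimately show ?thesis by (auto elim!: eventually_mono intro: order_trans)
    qed
    then show ?thesis using that[of h] hm hpos by (auto simp: less_imp_le)
  qed
qed

text \<open>On the line $e_j \cdot x = s$ the factor $g_j$ is $G H_f$ divided by the constant $f_j(s)$, so its integral is at most $N$.\<close>
lemma factorisation:
  assumes G[measurable]: "G \<in> borel_measurable borel" and G0: "\<And>x. 0 \<le> G x"
    and G_int: "(\<integral>\<^sup>+x. ennreal ((G x)\<^sup>2) \<partial>lborel) = ennreal (N\<^sup>2)" and N: "0 \<le> N"
  obtains g :: "3 \<Rightarrow> real^2 \<Rightarrow> real" where
    "\<And>j. g j \<in> borel_measurable borel" "\<And>j x. 0 \<le> g j x"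
    "AE x in lborel. G x \<le> (\<Prod>j\<in>UNIV. g j x) powr (1/3)"
    "\<And>j v. norm v = 1 \<Longrightarrow> e j \<bullet> v = 0 \<Longrightarrow> AE s in lborel.
      (\<integral>\<^sup>+t. ennreal (g j (s *\<^sub>R e j + t *\<^sub>R v)) \<partial>lborel) \<le> ennreal N"
proof -
  obtain f where fm[measurable]: "\<And>j. f j \<in> borel_measurable borel" and f0: "\<And>j s. 0 \<le> f j s"
    and pos: "AE x in lborel. 0 < G x \<longrightarrow> (\<forall>j. 0 < f j (e j \<bullet> x))"
    and EL: "\<And>j v. norm v = 1 \<Longrightarrow> e j \<bullet> v = 0 \<Longrightarrow> AE s in lborel.
      (\<integral>\<^sup>+t. ennreal (G (s *\<^sub>R e j + t *\<^sub>R v) * geom_mean f (s *\<^sub>R e j + t *\<^sub>R v)) \<partial>lborel) \<le> ennreal (N * f j s)"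
    using extremal_weights[OF assms] by blast
  \<comment> \<open>Division by zero gives $0$, so $g_j$ vanishes on the lines where $f_j$ does.\<close>
  define g where "g j x = G x * geom_mean f x / f j (e j \<bullet> x)" for j x
  show ?thesis
  proof
    show "g j \<in> borel_measurable borel" for j unfolding g_def by measurable
    show "0 \<le> g j x" for j x unfolding g_def using G0 f0 by simp
    show "AE x in lborel. G x \<le> (\<Prod>j\<in>UNIV. g j x) powr (1/3)"
      using pos
    proof eventually_elim
      fix x assume *: "0 < G x \<longrightarrow> (\<forall>j. 0 < f j (e j \<bullet> x))"
      show "G x \<le> (\<Prod>j\<in>UNIV. g j x) powr (1/3)"
      proof (cases "G x = 0")
        case False
        then have Gx: "0 < G x" using G0[of x] by simp
        let ?P = "\<Prod>j\<in>UNIV. f j (e j \<bullet> x)"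
        have P: "0 < ?P" using * Gx by (intro prod_pos) auto
        have "geom_mean f x ^ 3 = ?P"
          unfolding geom_mean_def using P by (simp add: powr_powr flip: powr_numeral)
        then have "(G x * geom_mean f x) ^ 3 / ?P = G x ^ 3"
          using nonzero_mult_div_cancel_right[OF less_imp_neq[OF P, symmetric], of "G x ^ 3"]
          by (simp only: power_mult_distrib)
        moreover have "(\<Prod>j\<in>UNIV. g j x) = (G x * geom_mean f x) ^ 3 / ?P"
          unfolding g_def prod_dividef by simp
        ultimately have "(\<Prod>j\<in>UNIV. g j x) = G x ^ 3" by (simp only:)
        then show ?thesis using Gx by (simp add: powr_powr flip: powr_numeral)
      qed simp
    qed
    fix j and v :: "real^2" assume v: "norm v = 1" "e j \<bullet> v = 0"
    have ee: "e j \<bullet> e j = 1" using norm_e by (simp add: norm_eq_1)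
    show "AE s in lborel. (\<integral>\<^sup>+t. ennreal (g j (s *\<^sub>R e j + t *\<^sub>R v)) \<partial>lborel) \<le> ennreal N"
      using EL[OF v]
    proof eventually_elim
      case (elim s)
      have "(\<integral>\<^sup>+t. ennreal (g j (s *\<^sub>R e j + t *\<^sub>R v)) \<partial>lborel)
        = ennreal (1 / f j s) * (\<integral>\<^sup>+t. ennreal (G (s *\<^sub>R e j + t *\<^sub>R v) * geom_mean f (s *\<^sub>R e j + t *\<^sub>R v)) \<partial>lborel)"
        using f0[of j s] G0 by (subst nn_integral_cmult[symmetric])
          (auto simp: g_def inner_add_right ee v ennreal_mult[symmetric])
      also have "\<dots> \<le> ennreal (1 / f j s) * ennreal (N * f j s)"
        by (intro mult_left_mono elim) simp
      also have "\<dots> \<le> ennreal N"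
        using f0[of j s] N by (cases "f j s = 0") (simp_all add: ennreal_mult[symmetric])
      finally show ?case .
    qed
  qed
qed

end

theorem theorem1p5:
  fixes v :: "3 \<Rightarrow> real^2"
  assumes "\<And>j. norm (v j) = 1"
    and "\<And>i j. i \<noteq> j \<Longrightarrow> angle_between (v i) (v j) = 2 * pi / 3"
  shows "\<forall>G :: real^2 \<Rightarrow> real. in_L2 G \<and> (AE x in lebesgue. 0 \<le> G x) \<longrightarrow>
    (\<exists>g :: 3 \<Rightarrow> real^2 \<Rightarrow> real.
       (\<forall>j. (\<forall>x. 0 \<le> g j x) \<and> locally_integrable (g j)) \<and>
       (AE x in lebesgue.
          G x \<le> g 1 x powr (1/3) * g 2 x powr (1/3) * g 3 x powr (1/3)) \<and>
       (\<forall>j. ae_line_integral_le (v j) (g j) (L2_norm G)))"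
proof (intro allI impI)
  fix G :: "real^2 \<Rightarrow> real" assume "in_L2 G \<and> (AE x in lebesgue. 0 \<le> G x)"
  then have G_meas: "G \<in> borel_measurable lebesgue" and G_int: "integrable lebesgue (\<lambda>x. (G x)\<^sup>2)"
    and G_nn: "AE x in lborel. 0 \<le> G x"
    by (auto simp: in_L2_def AE_completion_iff)
  have inner_v: "v i \<bullet> v j = - 1/2" if "i \<noteq> j" for i j
  proof -
    have "\<bar>v i \<bullet> v j\<bar> \<le> 1" using Cauchy_Schwarz_ineq2[of "v i" "v j"] assms(1) by simp
    moreover have "arccos (v i \<bullet> v j) = 2 * pi / 3"
      using assms(2)[OF that] assms(1) by (simp add: angle_between_def)
    ultimately have "v i \<bullet> v j = cos (2 * pi / 3)" by (metis cos_arccos_abs)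
    then show ?thesis by (simp add: cos_120)
  qed
  \<comment> \<open>Rotation by a right angle preserves the angles between the vectors.\<close>
  define e where "e j = (vector [- (v j $ 2), v j $ 1] :: real^2)" for j
  have ee: "e i \<bullet> e j = v i \<bullet> v j" for i j by (simp add: e_def inner_vec_def sum_2)
  have e_norm: "norm (e j) = 1" for j using assms(1)[of j] ee[of j j] by (simp add: norm_eq_1)
  have ev: "e j \<bullet> v j = 0" for j by (simp add: e_def inner_vec_def sum_2)
  interpret tripod e by unfold_locales (use e_norm ee inner_v in auto)
  obtain G' where G'[measurable]: "G' \<in> borel_measurable lborel" and GG': "AE x in lborel. G x = G' x"
    using completion_ex_borel_measurable_real[OF G_meas] by blast
  \<comment> \<open>A nonnegative Borel representative of $G$.\<close>
  define F where "F x = max 0 (G' x)" for x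
  have F[measurable]: "F \<in> borel_measurable borel" using G' unfolding F_def by simp
  have GF: "AE x in lborel. G x = F x" using GG' G_nn by eventually_elim (simp add: F_def)
  have N: "0 \<le> L2_norm G" by (simp add: L2_norm_def)
  have "(\<integral>\<^sup>+x. ennreal ((F x)\<^sup>2) \<partial>lborel) = (\<integral>\<^sup>+x. ennreal ((G x)\<^sup>2) \<partial>lborel)"
    by (rule nn_integral_cong_AE, use GF in eventually_elim) simp
  also have "\<dots> = ennreal (LINT x|lebesgue. (G x)\<^sup>2)"
    using nn_integral_eq_integral[OF G_int] by (simp add: nn_integral_completion)
  also have "\<dots> = ennreal ((L2_norm G)\<^sup>2)" by (simp add: L2_norm_def)
  finally have F_int: "(\<integral>\<^sup>+x. ennreal ((F x)\<^sup>2) \<partial>lborel) = ennreal ((L2_norm G)\<^sup>2)" .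
  obtain g where gm: "\<And>j. g j \<in> borel_measurable borel" and g0: "\<And>j x. 0 \<le> g j x"
    and Fg: "AE x in lborel. F x \<le> (\<Prod>j\<in>UNIV. g j x) powr (1/3)"
    and lines: "\<And>j v. norm v = 1 \<Longrightarrow> e j \<bullet> v = 0 \<Longrightarrow> AE s in lborel.
      (\<integral>\<^sup>+t. ennreal (g j (s *\<^sub>R e j + t *\<^sub>R v)) \<partial>lborel) \<le> ennreal (L2_norm G)"
    using factorisation[OF F _ F_int N] by (auto simp: F_def)
  have "AE x in lebesgue. G x \<le> g 1 x powr (1/3) * g 2 x powr (1/3) * g 3 x powr (1/3)"
    unfolding AE_completion_iff using Fg GF
    by eventually_elim (simp add: prod_3 powr_mult g0)
  moreover have "locally_integrable (g j)" "ae_line_integral_le (v j) (g j) (L2_norm G)" for j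
    using locally_integrableI[OF assms(1) e_norm ev gm g0 N lines[OF assms(1) ev]]
      line_integralI[OF assms(1) e_norm ev gm g0 N lines[OF assms(1) ev]] by auto
  ultimately show "\<exists>g :: 3 \<Rightarrow> real^2 \<Rightarrow> real.
       (\<forall>j. (\<forall>x. 0 \<le> g j x) \<and> locally_integrable (g j)) \<and>
       (AE x in lebesgue.
          G x \<le> g 1 x powr (1/3) * g 2 x powr (1/3) * g 3 x powr (1/3)) \<and>
       (\<forall>j. ae_line_integral_le (v j) (g j) (L2_norm G))"
    using g0 by blast
qed

end
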